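(* Let $G$ be a planar graph satisfying at least one of the following conditions: (i) no two triangles of $G$ are intersecting, and every triangle is adjacent to at most one $4$-cycle; (ii) no triangle of $G$ is adjacent to a triangle or a $4$-cycle, and every $5$-cycle is adjacent to at most three triangles. Then $G$ is single conflict $3$-colorable.
   Context: Graphs are finite and simple. Two (distinct) cycles are adjacent if they share a common edge; they are intersecting if they share a common vertex. A local $k$-partition of $G$ is a collection $\{c_v\}_{v\in V(G)}$ of maps $c_v : E(v)\to\{1,\dots,k\}$, where $E(v)$ is the set of edges incident with $v$. $G$ is conflict $\{c_v\}$-colorable if there is a map $\varphi : V(G)\to\{1,\dots,k\}$ such that no edge $e=xy$ satisfies both $\varphi(x)=c_x(e)$ and $\varphi(y)=c_y(e)$. $G$ is single conflict $k$-colorable if it is conflict $\{c_v\}$-colorable for every local $k$-partition $\{c_v\}$. *)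

theory Defs
  imports "HOL-Analysis.Analysis"
begin

text \<open>A finite simple graph is given by its vertex set \<open>V\<close> and its set \<open>E\<close> of edges, an edge being
  the two-element set of its ends.\<close>

definition simple_graph :: "'a set \<Rightarrow> 'a set set \<Rightarrow> bool" where
  "simple_graph V E \<longleftrightarrow> finite V \<and> (\<forall>e\<in>E. e \<subseteq> V \<and> card e = 2)"

definition incident_edges :: "'a set set \<Rightarrow> 'a \<Rightarrow> 'a set set" where
  "incident_edges E v = {e \<in> E. v \<in> e}"

text \<open>A drawing in the plane (here \<^typ>\<open>complex\<close>): distinct vertices are placed at distinct points,
  and an edge is an arc joining the images of its two ends. The third condition says that an arc
  meets no vertex other than its ends, the fourth that two arcs meet only in images of common ends.\<close>

definition plane_drawing ::
    "'a set \<Rightarrow> 'a set set \<Rightarrow> ('a \<Rightarrow> complex) \<Rightarrow> ('a set \<Rightarrow> real \<Rightarrow> complex) \<Rightarrow> bool" where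
  "plane_drawing V E p \<gamma> \<longleftrightarrow>
     inj_on p V \<and>
     (\<forall>e\<in>E. arc (\<gamma> e) \<and> {pathstart (\<gamma> e), pathfinish (\<gamma> e)} = p ` e) \<and>
     (\<forall>e\<in>E. path_image (\<gamma> e) \<inter> p ` V = p ` e) \<and>
     (\<forall>e\<in>E. \<forall>f\<in>E. e \<noteq> f \<longrightarrow> path_image (\<gamma> e) \<inter> path_image (\<gamma> f) \<subseteq> p ` (e \<inter> f))"

definition planar :: "'a set \<Rightarrow> 'a set set \<Rightarrow> bool" where
  "planar V E \<longleftrightarrow> (\<exists>p \<gamma>. plane_drawing V E p \<gamma>)"

text \<open>A cycle is a subgraph without isolated vertices, so it is identified with its edge set \<open>C\<close>;
  its vertex set is \<open>\<Union>C\<close>. Hence the different cyclic orderings of the same cycle are counted once.\<close>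

definition closed_walk_edges :: "'a list \<Rightarrow> 'a set set" where
  "closed_walk_edges vs = {{vs ! i, vs ! (Suc i mod length vs)} | i. i < length vs}"

definition is_cycle :: "'a set set \<Rightarrow> nat \<Rightarrow> 'a set set \<Rightarrow> bool" where
  "is_cycle E n C \<longleftrightarrow>
     n \<ge> 3 \<and> C \<subseteq> E \<and> (\<exists>vs. distinct vs \<and> length vs = n \<and> C = closed_walk_edges vs)"

abbreviation is_triangle :: "'a set set \<Rightarrow> 'a set set \<Rightarrow> bool" where
  "is_triangle E \<equiv> is_cycle E 3"

definition adjacent_cycles :: "'a set set \<Rightarrow> 'a set set \<Rightarrow> bool" where
  "adjacent_cycles C D \<longleftrightarrow> C \<noteq> D \<and> C \<inter> D \<noteq> {}"

definition intersecting_cycles :: "'a set set \<Rightarrow> 'a set set \<Rightarrow> bool" where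
  "intersecting_cycles C D \<longleftrightarrow> C \<noteq> D \<and> \<Union>C \<inter> \<Union>D \<noteq> {}"

definition local_partition ::
    "'a set \<Rightarrow> 'a set set \<Rightarrow> nat \<Rightarrow> ('a \<Rightarrow> 'a set \<Rightarrow> nat) \<Rightarrow> bool" where
  "local_partition V E k c \<longleftrightarrow> (\<forall>v\<in>V. c v \<in> incident_edges E v \<rightarrow> {1..k})"

definition conflict_colorable ::
    "'a set \<Rightarrow> 'a set set \<Rightarrow> nat \<Rightarrow> ('a \<Rightarrow> 'a set \<Rightarrow> nat) \<Rightarrow> bool" where
  "conflict_colorable V E k c \<longleftrightarrow>
     (\<exists>\<phi>. \<phi> \<in> V \<rightarrow> {1..k} \<and>
        \<not> (\<exists>x y. {x, y} \<in> E \<and> \<phi> x = c x {x, y} \<and> \<phi> y = c y {x, y}))"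

definition single_conflict_colorable :: "'a set \<Rightarrow> 'a set set \<Rightarrow> nat \<Rightarrow> bool" where
  "single_conflict_colorable V E k \<longleftrightarrow>
     (\<forall>c. local_partition V E k c \<longrightarrow> conflict_colorable V E k c)"

end

theory Submission
  imports Defs
begin

text \<open>If the edges of a graph can be oriented with all out-degrees at most 2, then a vertex only has to
  avoid the colours demanded by its at most two out-edges, so three colours suffice. By Hall's theorem
  such an orientation exists as soon as every nonempty set of edges spanning \<open>n\<close> vertices has at
  most \<open>2n - 3\<close> elements.

  Both conditions pass to subgraphs, so it is enough to refute a vertex-minimal plane graph with more
  than \<open>2n - 3\<close> edges. By minimality it has no separation along at most one vertex, hence it is
  built from a cycle by adding ears. Each ear splits a face bounded by a cycle into two such faces (the
  theta-curve form of the Jordan curve theorem), which yields Euler's formula together with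
  cycle-bounded faces such that every edge lies on exactly two of them. Give every face of length
  \<open>l\<close> the charge \<open>l - 4\<close>. Long faces can pay for the triangles they meet, 1/3 per shared edge under
  (ii) and 1/2 under (i), so the total charge is nonnegative and there are at most \<open>2n - 4\<close> edges.\<close>

section \<open>Orientations\<close>

text \<open>The constant 3 is forced from both sides. A single edge and a triangle attain
  \<open>2n - 3\<close>, so the bound \<open>2n - 4\<close> obtained from Euler's formula cannot
  itself be the inductive claim; and gluing two graphs with bound \<open>2n - 3\<close> at one
  vertex gives at most \<open>2(n + 1) - 6 = 2n - 4\<close> edges, so a minimal counterexample does
  not decompose in this way. A lone cycle, whose two faces have the same boundary, is treated apart,
  so that otherwise faces can be identified with their boundary edge sets.

  Under (ii) all three edges of a triangular face lie on faces of length at least 5. Such a face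
  affords \<open>3(l - 4)\<close> payments of 1/3, which is at least \<open>l\<close> once
  \<open>l >= 6\<close>; for \<open>l = 5\<close> it is 3, exactly the number of triangles allowed
  next to a 5-cycle. Under (i) one edge of a triangle may border a 4-face, so the share is 1/2. Then
  a 5-face affords two payments but may have three triangle edges.\<close>

lemma Hall_marriage:
  fixes A :: "'e \<Rightarrow> 'b set"
  assumes "finite I" "\<And>i. i \<in> I \<Longrightarrow> finite (A i)"
    and "\<And>J. J \<subseteq> I \<Longrightarrow> card J \<le> card (\<Union>(A ` J))"
  shows "\<exists>f. inj_on f I \<and> (\<forall>i\<in>I. f i \<in> A i)"
  using assms
proof (induction "card I" arbitrary: I A rule: less_induct)
  case less
  note fin = less.prems(1) and finA = less.prems(2) and hall = less.prems(3)
  show ?case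
  \<comment> \<open>Halmos-Vaughan: if some proper nonempty subfamily is tight, it and the rest are
    matched separately; otherwise every proper nonempty subfamily has a spare element, and one value
    can be fixed arbitrarily.\<close>
  proof (cases "\<exists>J. J \<subset> I \<and> J \<noteq> {} \<and> card J = card (\<Union>(A ` J))")
    case True
    then obtain J where J: "J \<subset> I" "J \<noteq> {}" "card J = card (\<Union>(A ` J))" by blast
    let ?U = "\<Union>(A ` J)"
    let ?B = "\<lambda>i. A i - ?U"
    have finJ: "finite J" using J(1) fin finite_subset by blast
    have finU: "finite ?U" using finJ J(1) finA by (intro finite_UN_I) auto
    have "\<exists>f. inj_on f J \<and> (\<forall>i\<in>J. f i \<in> A i)"
    proof (rule less.hyps)
      show "card J < card I" using psubset_card_mono[OF fin J(1)] .
      show "finite J" by fact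
      show "finite (A i)" if "i \<in> J" for i using finA that J(1) by blast
      show "card K \<le> card (\<Union>(A ` K))" if "K \<subseteq> J" for K using hall that J(1) by blast
    qed
    then obtain f where f: "inj_on f J" "\<forall>i\<in>J. f i \<in> A i" by blast
    have "\<exists>g. inj_on g (I - J) \<and> (\<forall>i\<in>I - J. g i \<in> ?B i)"
    proof (rule less.hyps)
      show "card (I - J) < card I" using J fin by (intro psubset_card_mono) auto
      show "finite (I - J)" "\<And>i. i \<in> I - J \<Longrightarrow> finite (?B i)" using fin finA by auto
      fix K assume K: "K \<subseteq> I - J"
      have finK: "finite K" using K fin finite_subset by blast
      have finUK: "finite (\<Union>(?B ` K))" using finK K finA by auto
      \<comment> \<open>Hall's condition for \<open>K \<union> J\<close> minus the tight equality
        for \<open>J\<close> leaves Hall's condition for \<open>K\<close> once the values of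
        \<open>J\<close> are removed.\<close>
      have "card K + card J = card (K \<union> J)" using K finK finJ by (intro card_Un_disjoint[symmetric]) auto
      also have "\<dots> \<le> card (\<Union>(A ` (K \<union> J)))" using K J by (intro hall) auto
      also have "\<Union>(A ` (K \<union> J)) = \<Union>(?B ` K) \<union> ?U" by auto
      also have "card \<dots> = card (\<Union>(?B ` K)) + card ?U"
        using finUK finU by (intro card_Un_disjoint) auto
      finally show "card K \<le> card (\<Union>(?B ` K))" using J(3) by simp
    qed
    then obtain g where g: "inj_on g (I - J)" "\<forall>i\<in>I - J. g i \<in> ?B i" by blast
    have sep: "f i \<noteq> g j" "g j \<noteq> f i" if "i \<in> J" "j \<in> I" "j \<notin> J" for i j
    proof -
      have "f i \<in> A i" "g j \<in> A j - ?U" using f(2) g(2) that by simp_all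
      then have "f i \<in> ?U" "g j \<notin> ?U" using that(1) by (blast, simp)
      then show "f i \<noteq> g j" "g j \<noteq> f i" by metis+
    qed
    let ?h = "\<lambda>i. if i \<in> J then f i else g i"
    have "inj_on ?h I"
    proof (rule inj_onI)
      fix i j assume ij: "i \<in> I" "j \<in> I" "?h i = ?h j"
      show "i = j"
      proof (cases "i \<in> J \<longleftrightarrow> j \<in> J")
        case True
        then show ?thesis using ij inj_onD[OF f(1), of i j] inj_onD[OF g(1), of i j] by (auto split: if_splits)
      next
        case False
        then show ?thesis using ij sep by (metis (full_types))
      qed
    qed
    moreover have "\<forall>i\<in>I. ?h i \<in> A i" using f(2) g(2) by simp
    ultimately show ?thesis by blast
  next
    case False
    show ?thesis
    proof (cases "I = {}")
      case nonempty: False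
      then obtain i where i: "i \<in> I" by blast
      have "card {i} \<le> card (A i)" using hall[of "{i}"] i by simp
      then have "A i \<noteq> {}" by auto
      then obtain x where x: "x \<in> A i" by blast
      let ?B = "\<lambda>j. A j - {x}"
      have "\<exists>g. inj_on g (I - {i}) \<and> (\<forall>j\<in>I - {i}. g j \<in> ?B j)"
      proof (rule less.hyps)
        show "card (I - {i}) < card I" using i fin by (intro psubset_card_mono) auto
        show "finite (I - {i})" "\<And>j. j \<in> I - {i} \<Longrightarrow> finite (?B j)" using fin finA by auto
        fix K assume K: "K \<subseteq> I - {i}"
        show "card K \<le> card (\<Union>(?B ` K))"
        proof (cases "K = {}")
          case ne: False
          have "K \<subset> I" using K i by blast
          then have "card K \<le> card (\<Union>(A ` K))" "card K \<noteq> card (\<Union>(A ` K))"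
            using hall[of K] False ne by (simp add: psubset_imp_subset, metis)
          \<comment> \<open>The strict surplus pays for the loss of the single value
            \<open>x\<close>.\<close>
          then have "card K \<le> card (\<Union>(A ` K)) - 1" by linarith
          also have "\<dots> \<le> card (\<Union>(A ` K) - {x})" by (simp add: card_Diff_singleton_if)
          also have "\<Union>(A ` K) - {x} = \<Union>(?B ` K)" by auto
          finally show ?thesis .
        qed simp
      qed
      then obtain g where g: "inj_on g (I - {i})" "\<forall>j\<in>I - {i}. g j \<in> ?B j" by blast
      have "inj_on (g(i := x)) I"
      proof (rule inj_onI)
        fix j k assume jk: "j \<in> I" "k \<in> I" "(g(i := x)) j = (g(i := x)) k"
        show "j = k"
          using jk g(2) inj_onD[OF g(1), of j k] by (cases "j = i"; cases "k = i") auto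
      qed
      moreover have "\<forall>j\<in>I. (g(i := x)) j \<in> A j" using g(2) x by simp
      ultimately show ?thesis by blast
    qed simp
  qed
qed

text \<open>A conflict on an edge needs both ends, so it is enough that one end, its tail
  \<open>fst (f e)\<close>, avoids the demanded colour.\<close>

lemma single_conflict_colorable_if_sparse:
  assumes G: "simple_graph V E"
    and sparse: "\<And>F. F \<subseteq> E \<Longrightarrow> card F \<le> 2 * card (\<Union>F)"
  shows "single_conflict_colorable V E 3"
proof -
  have finV: "finite V" and sub: "\<And>e. e \<in> E \<Longrightarrow> e \<subseteq> V" and card2: "\<And>e. e \<in> E \<Longrightarrow> card e = 2"
    using G by (auto simp: simple_graph_def)
  have finE: "finite E" using finV sub by (meson Pow_iff finite_Pow_iff finite_subset subsetI)
  \<comment> \<open>Each vertex offers two slots, told apart by a \<open>bool\<close>; an injective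
    choice of slots is an orientation with out-degrees at most 2.\<close>
  let ?A = "\<lambda>e :: 'a set. e \<times> (UNIV :: bool set)"
  have "\<exists>f. inj_on f E \<and> (\<forall>e\<in>E. f e \<in> ?A e)"
  proof (rule Hall_marriage[OF finE])
    show "finite (?A e)" if "e \<in> E" for e
      using card2[OF that] card_ge_0_finite[of e] by simp
    fix F assume F: "F \<subseteq> E"
    have "\<Union>(?A ` F) = \<Union>F \<times> UNIV" by auto
    then show "card F \<le> card (\<Union>(?A ` F))" using sparse[OF F] by (simp add: card_cartesian_product)
  qed
  then obtain f where f: "inj_on f E" "\<And>e. e \<in> E \<Longrightarrow> f e \<in> ?A e" by blast
  have out: "card {e \<in> E. fst (f e) = v} \<le> 2" for v
  proof -
    have "card {e \<in> E. fst (f e) = v} = card (f ` {e \<in> E. fst (f e) = v})"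
      using f(1) by (intro card_image[symmetric]) (auto simp: inj_on_def)
    also have "\<dots> \<le> card ({v} \<times> (UNIV :: bool set))"
      by (intro card_mono) (auto, metis fst_conv)
    finally show ?thesis by (simp add: card_cartesian_product)
  qed
  show ?thesis
    unfolding single_conflict_colorable_def conflict_colorable_def
  proof (intro allI impI)
    fix c :: "'a \<Rightarrow> 'a set \<Rightarrow> nat"
    have "\<exists>k\<in>{1..3}. \<forall>e\<in>E. fst (f e) = v \<longrightarrow> k \<noteq> c v e" for v
    proof (rule ccontr)
      assume "\<not> ?thesis"
      then have "{1..3} \<subseteq> c v ` {e \<in> E. fst (f e) = v}" by blast
      then have "card {1..3::nat} \<le> card (c v ` {e \<in> E. fst (f e) = v})"
        using finE by (intro card_mono) auto
      also have "\<dots> \<le> card {e \<in> E. fst (f e) = v}" using finE by (intro card_image_le) auto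
      finally show False using out[of v] by simp
    qed
    then obtain \<phi> where \<phi>: "\<And>v. \<phi> v \<in> {1..3::nat}" "\<And>v e. e \<in> E \<Longrightarrow> fst (f e) = v \<Longrightarrow> \<phi> v \<noteq> c v e"
      by metis
    have "fst (f {x, y}) = x \<or> fst (f {x, y}) = y" if "{x, y} \<in> E" for x y
      using f(2)[OF that] by auto
    then show "\<exists>\<phi>. \<phi> \<in> V \<rightarrow> {1..3} \<and>
        \<not> (\<exists>x y. {x, y} \<in> E \<and> \<phi> x = c x {x, y} \<and> \<phi> y = c y {x, y})"
      using \<phi> by (intro exI[of _ \<phi>]) blast
  qed
qed

section \<open>Theta curves\<close>

text \<open>The Jordan curve theorem for \<open>c1 +++ reversepath c2\<close>. Giving the curve as
  two arcs with common ends allows any two arcs of a theta to be selected later.\<close>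

lemma Jordan_arc_pair:
  fixes c1 c2 :: "real \<Rightarrow> complex"
  assumes "arc c1" "pathstart c1 = a" "pathfinish c1 = b"
    and "arc c2" "pathstart c2 = a" "pathfinish c2 = b"
    and int: "path_image c1 \<inter> path_image c2 = {a, b}"
  defines "S \<equiv> path_image c1 \<union> path_image c2"
  shows "compact S" "inside S \<noteq> {}" "open (inside S)" "connected (inside S)" "bounded (inside S)"
    "outside S \<noteq> {}" "open (outside S)" "connected (outside S)" "\<not> bounded (outside S)"
    "inside S \<inter> outside S = {}" "inside S \<union> outside S = - S"
    "frontier (inside S) = S" "frontier (outside S) = S"
proof -
  define g where "g = c1 +++ reversepath c2"
  have sp: "simple_path g"
    unfolding g_def using assms by (intro simple_path_join_loop) (auto simp: arc_reversepath)
  have loop: "pathfinish g = pathstart g" and im: "path_image g = S"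
    using assms by (auto simp: g_def path_image_join)
  note J = Jordan_inside_outside[OF sp loop, unfolded im]
  show "compact S" using compact_simple_path_image[OF sp] im by simp
  show "inside S \<noteq> {}" "open (inside S)" "connected (inside S)" "bounded (inside S)"
    "outside S \<noteq> {}" "open (outside S)" "connected (outside S)" "\<not> bounded (outside S)"
    "inside S \<inter> outside S = {}" "inside S \<union> outside S = - S"
    "frontier (inside S) = S" "frontier (outside S) = S"
    using J by auto
qed

text \<open>The three arcs play symmetric roles: each in turn can be treated as the chord of the
  closed curve formed by the other two.\<close>

locale theta =
  fixes c1 c2 c :: "real \<Rightarrow> complex" and a b :: complex
  assumes c1: "arc c1" "pathstart c1 = a" "pathfinish c1 = b"
    and c2: "arc c2" "pathstart c2 = a" "pathfinish c2 = b"
    and c: "arc c" "pathstart c = a" "pathfinish c = b"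
    and int12: "path_image c1 \<inter> path_image c2 = {a, b}"
    and int1c: "path_image c1 \<inter> path_image c = {a, b}"
    and int2c: "path_image c2 \<inter> path_image c = {a, b}"
begin

lemma ends_neq: "a \<noteq> b"
  using c1 arc_distinct_ends by blast

lemma connected_subset_region:
  assumes "connected U" "U \<inter> (path_image c1 \<union> path_image c2) = {}"
    and "U \<inter> W \<noteq> {}" "W = inside (path_image c1 \<union> path_image c2) \<or> W = outside (path_image c1 \<union> path_image c2)"
  shows "U \<subseteq> W"
proof -
  note J = Jordan_arc_pair[OF c1 c2 int12]
  have "U \<subseteq> inside (path_image c1 \<union> path_image c2) \<or> U \<subseteq> outside (path_image c1 \<union> path_image c2)"
    using connectedD[OF assms(1) J(3) J(7)] assms(2) J(10,11) by blast
  then show ?thesis using assms(3,4) J(10) by blast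
qed

end

lemma theta_perm: "theta c1 c2 c a b \<Longrightarrow> theta c2 c1 c a b" "theta c1 c2 c a b \<Longrightarrow> theta c1 c c2 a b"
  unfolding theta_def by (simp_all add: Int_commute)

context theta
begin

text \<open>If neither of \<open>c1\<close>, \<open>c2\<close> were enclosed, then a point enclosed by \<open>c2\<close> and \<open>c\<close> could be
  joined to infinity off \<open>c1 \<union> c2\<close> and off \<open>c1 \<union> c\<close>, hence by Janiszewski off the whole theta.\<close>

lemma outer_arc_encloses:
  assumes out: "path_image c - {a, b} \<subseteq> outside (path_image c1 \<union> path_image c2)"
  shows "path_image c2 \<inter> inside (path_image c1 \<union> path_image c) \<noteq> {}
    \<or> path_image c1 \<inter> inside (path_image c2 \<union> path_image c) \<noteq> {}"
proof (rule ccontr)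
  let ?A = "path_image c1" and ?B = "path_image c2" and ?C = "path_image c"
  assume "\<not> ?thesis"
  then have n2: "?B \<inter> inside (?A \<union> ?C) = {}" and n1: "?A \<inter> inside (?B \<union> ?C) = {}" by auto
  interpret t1: theta c1 c c2 a b using theta_axioms theta_perm by blast
  interpret t2: theta c2 c c1 a b using theta_axioms theta_perm by blast
  note J = Jordan_arc_pair[OF c1 c2 int12]
  note J1 = Jordan_arc_pair[OF t1.c1 t1.c2 t1.int12]
  note J2 = Jordan_arc_pair[OF t2.c1 t2.c2 t2.int12]
  have nA: "inside (?A \<union> ?B) \<inter> (?A \<union> ?B) = {}" "inside (?A \<union> ?C) \<inter> (?A \<union> ?C) = {}"
    "inside (?B \<union> ?C) \<inter> (?B \<union> ?C) = {}" by (rule inside_no_overlap)+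
  \<comment> \<open>Two such regions that meet, each missing the boundary of the other, would be
    equal; then their frontiers agree and \<open>c1\<close> consists of its ends only.\<close>
  have disj: "inside (?B \<union> ?C) \<inter> inside (?A \<union> ?B) = {}"
  proof (rule ccontr)
    assume ne: "inside (?B \<union> ?C) \<inter> inside (?A \<union> ?B) \<noteq> {}"
    have 1: "inside (?A \<union> ?B) \<inter> ?C = {}"
      using out J(10) nA(1) int12 by blast
    have "inside (?A \<union> ?B) \<subseteq> inside (?B \<union> ?C)"
      by (rule t2.connected_subset_region[OF J(4) _ _ disjI1[OF refl]]) (use 1 nA(1) ne in blast)+
    moreover have "inside (?B \<union> ?C) \<subseteq> inside (?A \<union> ?B)"
      by (rule connected_subset_region[OF J2(4) _ _ disjI1[OF refl]]) (use n1 nA(3) ne in blast)+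
    ultimately have "inside (?A \<union> ?B) = inside (?B \<union> ?C)" by (rule subset_antisym)
    then have "?A \<union> ?B = ?B \<union> ?C" using J(12) J2(12) by metis
    then have "?A \<subseteq> {a,b}" using int12 int1c by blast
    then show False using nonempty_simple_path_endless[of c1] c1 arc_imp_simple_path by auto
  qed
  have disj1: "inside (?B \<union> ?C) \<inter> inside (?A \<union> ?C) = {}"
  proof (rule ccontr)
    assume ne: "inside (?B \<union> ?C) \<inter> inside (?A \<union> ?C) \<noteq> {}"
    have "inside (?B \<union> ?C) \<subseteq> inside (?A \<union> ?C)"
      by (rule t1.connected_subset_region[OF J2(4) _ _ disjI1[OF refl]]) (use n1 nA(3) ne in blast)+
    moreover have "inside (?A \<union> ?C) \<subseteq> inside (?B \<union> ?C)"
      by (rule t2.connected_subset_region[OF J1(4) _ _ disjI1[OF refl]]) (use n2 nA(2) ne in blast)+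
    ultimately have "inside (?B \<union> ?C) = inside (?A \<union> ?C)" by (rule subset_antisym)
    then have "?A \<union> ?C = ?B \<union> ?C" using J1(12) J2(12) by metis
    then have "?A \<subseteq> {a,b}" using int12 int1c by blast
    then show False using nonempty_simple_path_endless[of c1] c1 arc_imp_simple_path by auto
  qed
  obtain x where x: "x \<in> inside (?B \<union> ?C)" using J2(2) by blast
  have x12: "x \<in> outside (?A \<union> ?B)" "x \<in> outside (?A \<union> ?C)"
    using x disj disj1 n1 nA(3) J(11) J1(11) by (blast, blast)
  have bd: "bounded (?A \<union> ?B \<union> ?C)"
    using J(1) J1(1) compact_imp_bounded by (metis Un_assoc bounded_Un)
  obtain y where y: "y \<in> outside (?A \<union> ?B \<union> ?C)"
    using outside_bounded_nonempty[OF bd] by blast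
  have y12: "y \<in> outside (?A \<union> ?B)" "y \<in> outside (?A \<union> ?C)" "y \<in> outside (?B \<union> ?C)"
    using y outside_mono[of "?A \<union> ?B" "?A \<union> ?B \<union> ?C"] outside_mono[of "?A \<union> ?C" "?A \<union> ?B \<union> ?C"]
      outside_mono[of "?B \<union> ?C" "?A \<union> ?B \<union> ?C"] by blast+
  have "connected_component (- (?A \<union> ?B)) x y" 
    unfolding connected_component_def using J(8,11) x12(1) y12(1) by blast
  moreover have "connected_component (- (?A \<union> ?C)) x y" 
    unfolding connected_component_def using J1(8,11) x12(2) y12(2) by blast
  \<comment> \<open>Janiszewski needs the two curves to share a connected set; here it is the arc
    \<open>c1\<close>.\<close>
  moreover have "connected ((?A \<union> ?B) \<inter> (?A \<union> ?C))"
  proof -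
    have "(?A \<union> ?B) \<inter> (?A \<union> ?C) = ?A" using int12 int2c by blast
    then show ?thesis using c1(1) by (simp add: arc_imp_path connected_path_image)
  qed
  ultimately have "connected_component (- ((?A \<union> ?B) \<union> (?A \<union> ?C))) x y"
    using Janiszewski J(1) J1(1) compact_imp_closed by blast
  then obtain U where U: "connected U" "U \<subseteq> - ((?A \<union> ?B) \<union> (?A \<union> ?C))" "x \<in> U" "y \<in> U"
    unfolding connected_component_def by blast
  then have "U \<subseteq> inside (?B \<union> ?C)"
    using t2.connected_subset_region[of U "inside (?B \<union> ?C)"] x by blast
  then show False using U(4) y12(3) J2(10) by blast
qed

text \<open>\<open>split_inside_simple_closed_curve\<close> singles out only the open arc; all of
  \<open>c\<close> can be subtracted because its ends lie on the outer curve.\<close>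

lemma split_inside:
  assumes ins: "path_image c - {a, b} \<subseteq> inside (path_image c1 \<union> path_image c2)"
  shows "inside (path_image c1 \<union> path_image c) \<inter> inside (path_image c2 \<union> path_image c) = {}"
    "inside (path_image c1 \<union> path_image c) \<union> inside (path_image c2 \<union> path_image c)
      = inside (path_image c1 \<union> path_image c2) - path_image c"
proof -
  let ?A = "path_image c1" and ?B = "path_image c2" and ?C = "path_image c"
  note sp = arc_imp_simple_path[OF c1(1)] arc_imp_simple_path[OF c2(1)] arc_imp_simple_path[OF c(1)]
  have ne: "?C \<inter> inside (?A \<union> ?B) \<noteq> {}"
    using ins nonempty_simple_path_endless[OF sp(3)] c by blast
  interpret t1: theta c1 c c2 a b using theta_axioms theta_perm by blast
  interpret t2: theta c2 c c1 a b using theta_axioms theta_perm by blast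
  note J = Jordan_arc_pair[OF c1 c2 int12]
  note J1 = Jordan_arc_pair[OF t1.c1 t1.c2 t1.int12]
  note J2 = Jordan_arc_pair[OF t2.c1 t2.c2 t2.int12]
  have nC: "z \<in> inside (?A \<union> ?C) \<Longrightarrow> z \<notin> ?C" "z \<in> inside (?B \<union> ?C) \<Longrightarrow> z \<notin> ?C"
     "a \<notin> inside (?A \<union> ?B)" "b \<notin> inside (?A \<union> ?B)" for z
    using J1(11) J2(11) J(11) int12 by blast+
  show 1: "inside (?A \<union> ?C) \<inter> inside (?B \<union> ?C) = {}"
    and "inside (?A \<union> ?C) \<union> inside (?B \<union> ?C) = inside (?A \<union> ?B) - ?C"
    using split_inside_simple_closed_curve[OF sp(1) c1(2,3) sp(2) c2(2,3) sp(3) c(2,3) ends_neq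
        int12 int1c int2c ne] nC by auto
qed

end

text \<open>Avoids inside and outside, so that bounded and unbounded faces are split by the same
  rule: \<open>C\<close> is a chord of \<open>R\<close> that divides the boundary of
  \<open>R\<close> into \<open>A\<close> and \<open>B\<close>.\<close>

definition region_split :: "complex set \<Rightarrow> complex set \<Rightarrow> complex set \<Rightarrow> complex set \<Rightarrow> bool" where
  "region_split R A B C \<longleftrightarrow> (\<exists>R1 R2. open R1 \<and> connected R1 \<and> R1 \<noteq> {} \<and>
    open R2 \<and> connected R2 \<and> R2 \<noteq> {} \<and> R1 \<inter> R2 = {} \<and> R1 \<union> R2 = R - C \<and>
    frontier R1 = A \<union> C \<and> frontier R2 = B \<union> C)"

lemma region_split_commute: "region_split R A B C \<Longrightarrow> region_split R B A C"
  unfolding region_split_def by (metis Int_commute Un_commute)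

text \<open>A chord of the bounded region is handled by \<open>split_inside\<close>. For a chord of
  the unbounded region, one of the other arcs is enclosed by the remaining arc and the chord; with
  the roles permuted it is an inner chord, and \<open>split_inside\<close> applies again.\<close>

lemma theta_split:
  fixes c1 c2 c :: "real \<Rightarrow> complex"
  assumes th: "theta c1 c2 c a b"
    and R: "R = inside (path_image c1 \<union> path_image c2) \<or> R = outside (path_image c1 \<union> path_image c2)"
    and sub: "path_image c - {a, b} \<subseteq> R"
  shows "region_split R (path_image c1) (path_image c2) (path_image c)"
proof -
  \<comment> \<open>The unbounded case with \<open>c2\<close> enclosed; the case with
    \<open>c1\<close> enclosed follows by exchanging the two arcs.\<close>
  have *: "region_split (outside (path_image c1 \<union> path_image c2)) (path_image c1) (path_image c2) (path_image c)"
    if th: "theta c1 c2 c a b" and out: "path_image c - {a, b} \<subseteq> outside (path_image c1 \<union> path_image c2)"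
      and enc: "path_image c2 \<inter> inside (path_image c1 \<union> path_image c) \<noteq> {}" for c1 c2
  proof -
    interpret theta c1 c2 c a b by fact
    let ?A = "path_image c1" and ?B = "path_image c2" and ?C = "path_image c"
    interpret t1: theta c1 c c2 a b using theta_axioms theta_perm by blast
    interpret t2: theta c2 c c1 a b using theta_axioms theta_perm by blast
    note J = Jordan_arc_pair[OF c1 c2 int12]
    note J1 = Jordan_arc_pair[OF t1.c1 t1.c2 t1.int12]
    note J2 = Jordan_arc_pair[OF t2.c1 t2.c2 t2.int12]
    have con: "connected (?B - {a, b})"
      using connected_simple_path_endless[OF arc_imp_simple_path[OF c2(1)]] c2 by simp
    have abs: "{a, b} \<inter> inside (?A \<union> ?C) = {}"
      using J1(11) int1c by blast
    have "?B - {a, b} \<subseteq> inside (?A \<union> ?C)"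
      by (rule t1.connected_subset_region[OF con _ _ disjI1[OF refl]]) (use enc int12 int2c abs in blast)+
    note S = t1.split_inside[OF this]
    \<comment> \<open>The two parts of the unbounded region are what \<open>c2\<close> and
      \<open>c\<close> enclose and the outside of \<open>c1\<close> and \<open>c\<close>.\<close>
    have "inside (?B \<union> ?C) \<union> outside (?A \<union> ?C) = outside (?A \<union> ?B) - ?C"
    proof -
      have "inside (?B \<union> ?C) \<inter> inside (?A \<union> ?B) = {}" using S(1) by (simp add: Un_commute Int_commute)
      moreover have "inside (?A \<union> ?B) \<union> inside (?B \<union> ?C) = inside (?A \<union> ?C) - ?B"
        using S(2) by (simp add: Un_commute)
      ultimately have s1: "inside (?B \<union> ?C) \<inter> inside (?A \<union> ?B) = {}"
        and s2: "inside (?A \<union> ?B) \<union> inside (?B \<union> ?C) = inside (?A \<union> ?C) - ?B" by simp_all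
      have mAB: "z \<in> inside (?A \<union> ?B) \<or> z \<in> outside (?A \<union> ?B) \<longleftrightarrow> z \<notin> ?A \<and> z \<notin> ?B" for z
        using J(11) by blast
      have mAC: "z \<in> inside (?A \<union> ?C) \<or> z \<in> outside (?A \<union> ?C) \<longleftrightarrow> z \<notin> ?A \<and> z \<notin> ?C" for z
        using J1(11) by blast
      have oAC: "z \<in> outside (?A \<union> ?C) \<longleftrightarrow> z \<notin> inside (?A \<union> ?C) \<and> z \<notin> ?A \<and> z \<notin> ?C" for z
        using mAC[of z] J1(10) by blast
      have oAB: "z \<in> outside (?A \<union> ?B) \<longleftrightarrow> z \<notin> inside (?A \<union> ?B) \<and> z \<notin> ?A \<and> z \<notin> ?B" for z
        using mAB[of z] J(10) by blast
      have z2: "z \<in> inside (?A \<union> ?B) \<or> z \<in> inside (?B \<union> ?C) \<longleftrightarrow> z \<in> inside (?A \<union> ?C) \<and> z \<notin> ?B" for z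
        using s2 by blast
      have z1: "\<not> (z \<in> inside (?B \<union> ?C) \<and> z \<in> inside (?A \<union> ?B))" for z
        using s1 by blast
      have zB: "z \<in> ?B \<Longrightarrow> z \<notin> inside (?A \<union> ?C) \<Longrightarrow> z \<in> ?A" for z
        using \<open>?B - {a, b} \<subseteq> inside (?A \<union> ?C)\<close> int12 by blast
      show ?thesis
        by (rule set_eqI) (metis DiffI DiffD1 DiffD2 UnE UnI1 UnI2 mAC oAB oAC z1 z2 zB)
    qed
    moreover have "inside (?B \<union> ?C) \<inter> outside (?A \<union> ?C) = {}" 
    proof -
      have "inside (?C \<union> ?B) \<subseteq> inside (?A \<union> ?C)" using S(2) by blast
      then show ?thesis using J1(10) unfolding Un_commute[of ?C ?B] by blast
    qed
    ultimately show ?thesis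
      unfolding region_split_def Int_commute[of "inside _"] Un_commute[of "inside _"]
      using J1(6,7,8,13) J2(2,3,4,12) by metis
  qed
  interpret theta c1 c2 c a b by fact
  interpret t1: theta c1 c c2 a b using theta_axioms theta_perm by blast
  interpret t2: theta c2 c c1 a b using theta_axioms theta_perm by blast
  let ?A = "path_image c1" and ?B = "path_image c2" and ?C = "path_image c"
  note J = Jordan_arc_pair[OF c1 c2 int12]
  note J1 = Jordan_arc_pair[OF t1.c1 t1.c2 t1.int12]
  note J2 = Jordan_arc_pair[OF t2.c1 t2.c2 t2.int12]
  from R show ?thesis
  proof
    assume i: "R = inside (?A \<union> ?B)"
    show ?thesis
      unfolding region_split_def i
      using split_inside[OF sub[unfolded i]] J1(2,3,4,12) J2(2,3,4,12) by metis
  next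
    assume o: "R = outside (?A \<union> ?B)"
    have out: "?C - {a, b} \<subseteq> outside (?A \<union> ?B)" using sub o by simp
    from outer_arc_encloses[OF out] show ?thesis
    proof
      assume "?B \<inter> inside (?A \<union> ?C) \<noteq> {}"
      from *[OF th out this] show ?thesis unfolding o .
    next
      assume enc: "?A \<inter> inside (?B \<union> ?C) \<noteq> {}"
      have out': "?C - {a, b} \<subseteq> outside (?B \<union> ?A)" using out by (simp add: Un_commute)
      from region_split_commute[OF *[OF theta_perm(1)[OF th] out' enc]]
      show ?thesis unfolding o by (simp only: Un_commute)
    qed
  qed
qed

section \<open>Paths and cycles\<close>

text \<open>Paths are vertex lists, and a cycle is the list \<open>x # xs @ [x]\<close>, so one
  function and its append rules serve both.\<close>

fun path_edges :: "'a list \<Rightarrow> 'a set set" where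
  "path_edges (x # y # zs) = insert {x, y} (path_edges (y # zs))"
| "path_edges _ = {}"

lemma path_edges_append: "path_edges (xs @ y # zs) = path_edges (xs @ [y]) \<union> path_edges (y # zs)"
proof (induction xs)
  case (Cons x xs)
  then show ?case by (cases xs) auto
qed simp

lemma path_edges_snoc2: "path_edges (xs @ [x, y]) = insert {x, y} (path_edges (xs @ [x]))"
  using path_edges_append[of xs x "[y]"] by simp

lemma path_edges_rev: "path_edges (rev xs) = path_edges xs"
proof (induction xs rule: path_edges.induct)
  case (1 x y zs)
  then show ?case by (simp add: path_edges_snoc2 insert_commute)
qed simp_all

lemma finite_path_edges [simp]: "finite (path_edges xs)"
  by (induction xs rule: path_edges.induct) auto

lemma Union_path_edges_subset: "\<Union>(path_edges xs) \<subseteq> set xs"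
  by (induction xs rule: path_edges.induct) auto

lemma Union_path_edges: "2 \<le> length xs \<Longrightarrow> \<Union>(path_edges xs) = set xs"
proof (induction xs rule: path_edges.induct)
  case (1 x y zs)
  then show ?case by (cases zs) auto
qed auto

lemma path_edges_memD: "e \<in> path_edges xs \<Longrightarrow> v \<in> e \<Longrightarrow> v \<in> set xs"
  using Union_path_edges_subset by fastforce

lemma path_edges_card2: "distinct xs \<Longrightarrow> e \<in> path_edges xs \<Longrightarrow> card e = 2"
  by (induction xs rule: path_edges.induct) auto

lemma path_edges_at_head: "distinct (x # xs) \<Longrightarrow> e \<in> path_edges (x # xs) \<Longrightarrow> x \<in> e \<Longrightarrow> xs \<noteq> [] \<and> e = {x, hd xs}"
  by (cases xs) (auto dest: path_edges_memD)

lemma card_path_edges: "distinct xs \<Longrightarrow> card (path_edges xs) = length xs - 1"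
proof (induction xs rule: path_edges.induct)
  case (1 x y zs)
  have "{x, y} \<notin> path_edges (y # zs)"
    using path_edges_memD[of "{x, y}" "y # zs" x] 1(2) by auto
  then show ?case using 1 by simp
qed auto

lemma path_edges_conv_nth: "path_edges xs = {{xs ! i, xs ! Suc i} | i. Suc i < length xs}"
proof (induction xs rule: path_edges.induct)
  case (1 x y zs)
  have "{{(x # y # zs) ! i, (x # y # zs) ! Suc i} | i. Suc i < length (x # y # zs)}
    = insert {x, y} {{(y # zs) ! i, (y # zs) ! Suc i} | i. Suc i < length (y # zs)}" (is "?L = ?R")
  proof
    show "?L \<subseteq> ?R"
    proof
      fix e assume "e \<in> ?L"
      then obtain i where i: "e = {(x # y # zs) ! i, (x # y # zs) ! Suc i}" "Suc i < length (x # y # zs)" by blast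
      show "e \<in> ?R" using i by (cases i) auto
    qed
    show "?R \<subseteq> ?L"
    proof
      fix e assume "e \<in> ?R"
      then consider "e = {x, y}" | i where "e = {(y # zs) ! i, (y # zs) ! Suc i}" "Suc i < length (y # zs)" by blast
      then show "e \<in> ?L"
      proof cases
        case 1
        then show ?thesis by (auto intro!: exI[of _ 0])
      next
        case 2
        then show ?thesis by (auto intro!: exI[of _ "Suc i"])
      qed
    qed
  qed
  with 1 show ?case by simp
qed auto

text \<open>Only the last index wraps around, and there the repeated \<open>x\<close> at the end of
  the list replaces the modulus.\<close>

lemma closed_walk_edges_Cons: "closed_walk_edges (x # xs) = path_edges (x # xs @ [x])"
proof -
  let ?n = "length (x # xs)"
  have eq: "{(x # xs) ! i, (x # xs) ! (Suc i mod ?n)} = {(x # xs @ [x]) ! i, (x # xs @ [x]) ! Suc i}"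
    if "i < ?n" for i
  proof (cases "Suc i = ?n")
    case True
    then have "(x # xs @ [x]) ! i = (x # xs) ! i" "(x # xs @ [x]) ! Suc i = x"
      by (metis append_Cons lessI nth_append) (use True in \<open>simp add: nth_append\<close>)
    then show ?thesis using True by simp
  next
    case False
    then have "Suc i < ?n" using that by simp
    then show ?thesis by (metis (no_types, lifting) append_Cons mod_less nth_append that)
  qed
  show ?thesis
    unfolding closed_walk_edges_def path_edges_conv_nth using eq by (intro Collect_cong) (metis length_Cons length_append_singleton Suc_less_eq)
qed

lemma is_cycle_iff: "is_cycle E n C \<longleftrightarrow>
  n \<ge> 3 \<and> C \<subseteq> E \<and> (\<exists>x xs. distinct (x # xs) \<and> Suc (length xs) = n \<and> C = path_edges (x # xs @ [x]))"
proof
  assume "is_cycle E n C"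
  then obtain vs where vs: "n \<ge> 3" "C \<subseteq> E" "distinct vs" "length vs = n" "C = closed_walk_edges vs"
    unfolding is_cycle_def by blast
  then obtain x xs where "vs = x # xs" by (cases vs) auto
  then show "n \<ge> 3 \<and> C \<subseteq> E \<and> (\<exists>x xs. distinct (x # xs) \<and> Suc (length xs) = n \<and> C = path_edges (x # xs @ [x]))"
    using vs closed_walk_edges_Cons by (metis length_Cons)
next
  assume "n \<ge> 3 \<and> C \<subseteq> E \<and> (\<exists>x xs. distinct (x # xs) \<and> Suc (length xs) = n \<and> C = path_edges (x # xs @ [x]))"
  then show "is_cycle E n C"
    unfolding is_cycle_def using closed_walk_edges_Cons by (metis length_Cons)
qed

lemma is_cycle_mono: "is_cycle E n C \<Longrightarrow> E \<subseteq> E' \<Longrightarrow> is_cycle E' n C"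
  unfolding is_cycle_def by blast

text \<open>The closed list is cut at \<open>v\<close> and its two pieces are exchanged.\<close>

lemma is_cycle_rotate:
  assumes "is_cycle E n C" "v \<in> \<Union>C"
  obtains xs where "distinct (v # xs)" "Suc (length xs) = n" "C = path_edges (v # xs @ [v])"
proof -
  from assms(1)[unfolded is_cycle_iff] obtain x xs
    where x: "distinct (x # xs)" "Suc (length xs) = n" "C = path_edges (x # xs @ [x])"
    by (elim conjE exE)
  have "v \<in> set (x # xs @ [x])" using assms(2) x(3) subsetD[OF Union_path_edges_subset] by metis
  then have "v \<in> set (x # xs)" by simp
  then obtain as bs where ab: "x # xs = as @ v # bs" by (meson split_list)
  show ?thesis
  proof (cases as)
    case Nil
    then show ?thesis using that x ab by simp
  next
    case (Cons y as')
    then have [simp]: "y = x" and xs: "xs = as' @ v # bs" using ab by auto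
    have "C = path_edges ((x # as') @ v # bs @ [x])" using x(3) xs by simp
    also have "\<dots> = path_edges ((v # bs) @ [x]) \<union> path_edges (x # as' @ [v])"
      by (subst path_edges_append) auto
    also have "\<dots> = path_edges ((v # bs) @ x # as' @ [v])"
      by (rule path_edges_append[symmetric])
    finally show ?thesis using that[of "bs @ x # as'"] x(1,2) xs by auto
  qed
qed

text \<open>If \<open>xs\<close> had a single element, the closing edge would repeat the only edge
  of the path; hence the length condition.\<close>

lemma closing_edge_notin:
  assumes "distinct (x # xs)" "2 \<le> length xs"
  shows "{last xs, x} \<notin> path_edges (x # xs)"
proof
  assume "{last xs, x} \<in> path_edges (x # xs)"
  then have "{last xs, x} = {x, hd xs}" using path_edges_at_head[OF assms(1)] by blast
  then have "last xs = hd xs" by (auto simp: doubleton_eq_iff)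
  then show False using assms by (cases xs) (auto split: if_splits)
qed

lemma closed_path_edges: "xs \<noteq> [] \<Longrightarrow> path_edges (x # xs @ [x]) = insert {last xs, x} (path_edges (x # xs))"
proof (cases xs rule: rev_exhaust)
  case (snoc ys y)
  then show ?thesis using path_edges_snoc2[of "x # ys" y x] by simp
qed simp

lemma card_closed_path_edges:
  assumes "distinct (x # xs)" "2 \<le> length xs"
  shows "card (path_edges (x # xs @ [x])) = Suc (length xs)"
proof -
  have "path_edges (x # xs @ [x]) = insert {last xs, x} (path_edges (x # xs))"
    by (rule closed_path_edges) (use assms(2) in auto)
  then show ?thesis
    using closing_edge_notin[OF assms] card_path_edges[OF assms(1)] assms(2) by simp
qed

lemma is_cycle_card: "is_cycle E n C \<Longrightarrow> card C = n \<and> finite C"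
  unfolding is_cycle_iff using card_closed_path_edges by (elim conjE exE) fastforce

lemma closed_path_edges_at:
  assumes "distinct (v # xs)" "2 \<le> length xs" "e \<in> path_edges (v # xs @ [v])" "v \<in> e"
  shows "e = {v, hd xs} \<or> e = {v, last xs}"
proof -
  have "path_edges (v # xs @ [v]) = insert {last xs, v} (path_edges (v # xs))"
    by (rule closed_path_edges) (use assms(2) in auto)
  then have "e = {last xs, v} \<or> e \<in> path_edges (v # xs)" using assms(3) by blast
  then show ?thesis using path_edges_at_head[OF assms(1)] assms(4) by blast
qed

text \<open>Both arcs are listed from \<open>v\<close> to \<open>w\<close>, as the arcs of a theta
  require, so the second is read backwards.\<close>

lemma is_cycle_split:
  assumes C: "is_cycle E n C" and vw: "v \<in> \<Union>C" "w \<in> \<Union>C" "v \<noteq> w"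
  obtains as bs where "distinct (v # as @ w # bs)"
    "C = path_edges (v # as @ [w]) \<union> path_edges (v # bs @ [w])"
    "path_edges (v # as @ [w]) \<inter> path_edges (v # bs @ [w]) = {}"
proof -
  obtain xs where xs: "distinct (v # xs)" "Suc (length xs) = n" "C = path_edges (v # xs @ [v])"
    using is_cycle_rotate[OF C vw(1)] by blast
  have "w \<in> set (v # xs @ [v])" using vw(2) xs(3) subsetD[OF Union_path_edges_subset] by metis
  then have "w \<in> set xs" using vw(3) by simp
  then obtain as bs where ab: "xs = as @ w # bs" by (meson split_list)
  let ?A = "path_edges (v # as @ [w])" and ?B = "path_edges (v # rev bs @ [w])"
  have "path_edges (w # bs @ [v]) = ?B" using path_edges_rev[of "w # bs @ [v]"] by simp
  then have Ceq: "C = ?A \<union> ?B"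
    using xs(3) path_edges_append[of "v # as" w "bs @ [v]"] ab by simp
  have d: "distinct (v # as @ w # rev bs)" using xs(1) ab by auto
  \<comment> \<open>The edge numbers of the two arcs add up to \<open>n\<close>, the size of their
    union \<open>C\<close>; hence no edge is common.\<close>
  have "card C = n" using is_cycle_card[OF C] by simp
  moreover have "card ?A + card ?B = n"
    using card_path_edges[of "v # as @ [w]"] card_path_edges[of "v # rev bs @ [w]"] d xs(2) ab by auto
  moreover have "card ?A + card ?B = card (?A \<union> ?B) + card (?A \<inter> ?B)"
    by (rule card_Un_Int) auto
  ultimately have "card (?A \<inter> ?B) = 0" using Ceq by simp
  then have "?A \<inter> ?B = {}" by simp
  then show ?thesis using that[of as "rev bs"] d Ceq by blast
qed

text \<open>Two arcs that are single edges from \<open>v\<close> to \<open>w\<close> would coincide;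
  the second assumption rules this out.\<close>

lemma is_cycle_join:
  assumes "distinct (v # as @ w # bs)" "as \<noteq> [] \<or> bs \<noteq> []"
    and "path_edges (v # as @ [w]) \<union> path_edges (v # bs @ [w]) \<subseteq> E"
  shows "is_cycle E (length as + length bs + 2) (path_edges (v # as @ [w]) \<union> path_edges (v # bs @ [w]))"
proof -
  have "path_edges (v # bs @ [w]) = path_edges (w # rev bs @ [v])"
    using path_edges_rev[of "v # bs @ [w]"] by simp
  then have "path_edges (v # as @ [w]) \<union> path_edges (v # bs @ [w]) = path_edges (v # (as @ w # rev bs) @ [v])"
    using path_edges_append[of "v # as" w "rev bs @ [v]"] by simp
  moreover have "distinct (v # as @ w # rev bs)" using assms(1) by auto
  moreover have "3 \<le> length as + length bs + 2" using assms(2) by (cases as; cases bs) auto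
  ultimately show ?thesis unfolding is_cycle_iff using assms(3)
    by (intro conjI exI[of _ v] exI[of _ "as @ w # rev bs"]) auto
qed

lemma is_cycle_3_iff: "is_cycle E 3 T \<longleftrightarrow>
  (\<exists>a b c. distinct [a, b, c] \<and> T = {{a, b}, {b, c}, {c, a}} \<and> T \<subseteq> E)"
proof
  assume "is_cycle E 3 T"
  then obtain a xs where a: "T \<subseteq> E" "distinct (a # xs)" "Suc (length xs) = 3" "T = path_edges (a # xs @ [a])"
    unfolding is_cycle_iff by (elim conjE exE)
  then obtain b c where "xs = [b, c]" by (auto simp: eval_nat_numeral length_Suc_conv)
  then show "\<exists>a b c. distinct [a, b, c] \<and> T = {{a, b}, {b, c}, {c, a}} \<and> T \<subseteq> E"
    using a by (intro exI[of _ a] exI[of _ b] exI[of _ c]) auto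
next
  assume "\<exists>a b c. distinct [a, b, c] \<and> T = {{a, b}, {b, c}, {c, a}} \<and> T \<subseteq> E"
  then obtain a b c where "distinct [a, b, c]" "T = {{a, b}, {b, c}, {c, a}}" "T \<subseteq> E" by (elim conjE exE)
  then show "is_cycle E 3 T"
    unfolding is_cycle_iff by (intro conjI exI[of _ a] exI[of _ "[b, c]"]) auto
qed

lemma is_cycle_4I: "distinct [a, b, c, d] \<Longrightarrow> {{a, b}, {b, c}, {c, d}, {d, a}} \<subseteq> E \<Longrightarrow>
    is_cycle E 4 {{a, b}, {b, c}, {c, d}, {d, a}}"
  unfolding is_cycle_iff by (intro conjI exI[of _ a] exI[of _ "[b, c, d]"]) auto

section \<open>Faces of a plane graph\<close>

text \<open>Serves to place the ends of an ear: they are limits of its interior, hence lie in the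
  closure of the face containing the interior.\<close>

lemma arc_ends_in_closure_endless:
  fixes g :: "real \<Rightarrow> 'a::real_normed_vector"
  assumes "arc g"
  shows "path_image g \<subseteq> closure (path_image g - {pathstart g, pathfinish g})"
proof -
  have "g ` closure {0<..<1} \<subseteq> closure (g ` {0<..<1})"
    using assms by (intro image_closure_subset closure_subset closed_closure) (simp_all add: arc_def path_def)
  then show ?thesis
    unfolding simple_path_endless[OF arc_imp_simple_path[OF assms]] by (simp add: path_image_def)
qed

lemma connected_in_disjoint_open_family:
  assumes "connected U" "U \<subseteq> \<Union>\<R>" "\<And>R. R \<in> \<R> \<Longrightarrow> open R" "R \<in> \<R>" "U \<inter> R \<noteq> {}"
    and "\<And>S. S \<in> \<R> \<Longrightarrow> S \<noteq> R \<Longrightarrow> R \<inter> S = {}"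
  shows "U \<subseteq> R"
proof (rule ccontr)
  assume "\<not> U \<subseteq> R"
  let ?O = "\<Union>(\<R> - {R})"
  have o: "open R" "open ?O" using assms(3,4) by auto
  have cov: "U \<subseteq> R \<union> ?O"
  proof
    fix x assume "x \<in> U"
    then obtain S where "S \<in> \<R>" "x \<in> S" using assms(2) by blast
    then show "x \<in> R \<union> ?O" by (cases "S = R") auto
  qed
  have dj: "R \<inter> ?O = {}" using assms(6) by auto
  have "?O \<inter> U \<noteq> {}" using cov \<open>\<not> U \<subseteq> R\<close> by blast
  then show False
    using connectedD[OF assms(1) o, of] dj cov assms(5) by (metis Int_commute inf_bot_right inf_assoc)
qed

locale plane_graph =
  fixes V :: "'a set" and E :: "'a set set" and p :: "'a \<Rightarrow> complex" and \<gamma> :: "'a set \<Rightarrow> real \<Rightarrow> complex"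
  assumes graph: "simple_graph V E" and drawing: "plane_drawing V E p \<gamma>"
begin

definition drawn :: "'a set set \<Rightarrow> complex set" where
  "drawn H = (\<Union>e\<in>H. path_image (\<gamma> e))"

lemma finite_vertices: "finite V" and edge_subset: "e \<in> E \<Longrightarrow> e \<subseteq> V" and edge_card: "e \<in> E \<Longrightarrow> card e = 2"
  using graph by (auto simp: simple_graph_def)

lemma finite_edges: "finite E"
  using finite_vertices edge_subset by (meson Pow_iff finite_Pow_iff finite_subset subsetI)

lemma inj_p: "inj_on p V"
  and edge_arc: "e \<in> E \<Longrightarrow> arc (\<gamma> e)"
  and edge_ends: "e \<in> E \<Longrightarrow> {pathstart (\<gamma> e), pathfinish (\<gamma> e)} = p ` e"
  and edge_vertices: "e \<in> E \<Longrightarrow> path_image (\<gamma> e) \<inter> p ` V = p ` e"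
  and edges_cross: "e \<in> E \<Longrightarrow> f \<in> E \<Longrightarrow> e \<noteq> f \<Longrightarrow> path_image (\<gamma> e) \<inter> path_image (\<gamma> f) \<subseteq> p ` (e \<inter> f)"
  using drawing unfolding plane_drawing_def by auto

lemma drawn_Un: "drawn (A \<union> B) = drawn A \<union> drawn B"
  by (simp add: drawn_def)

lemma drawn_Int:
  assumes "A \<subseteq> E" "B \<subseteq> E" "A \<inter> B = {}"
  shows "drawn A \<inter> drawn B \<subseteq> p ` (\<Union>A \<inter> \<Union>B)"
proof
  fix z assume "z \<in> drawn A \<inter> drawn B"
  then obtain e f where ef: "e \<in> A" "f \<in> B" "z \<in> path_image (\<gamma> e)" "z \<in> path_image (\<gamma> f)"
    by (auto simp: drawn_def)
  then have "e \<in> E" "f \<in> E" "e \<noteq> f" using assms by auto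
  then have "z \<in> p ` (e \<inter> f)" using edges_cross[of e f] ef by blast
  then show "z \<in> p ` (\<Union>A \<inter> \<Union>B)" using ef by blast
qed

lemma vertex_drawn_iff:
  assumes "H \<subseteq> E" "v \<in> V"
  shows "p v \<in> drawn H \<longleftrightarrow> v \<in> \<Union>H"
proof -
  have "p v \<in> path_image (\<gamma> e) \<longleftrightarrow> v \<in> e" if "e \<in> H" for e
  proof -
    have e: "e \<in> E" using that assms(1) by auto
    have "p v \<in> path_image (\<gamma> e) \<longleftrightarrow> p v \<in> p ` e" using edge_vertices[OF e] assms(2) by blast
    also have "\<dots> \<longleftrightarrow> v \<in> e" using inj_p edge_subset[OF e] assms(2) by (simp add: inj_on_image_mem_iff)
    finally show ?thesis .
  qed
  then show ?thesis by (auto simp: drawn_def)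
qed

lemma Union_subset_V: "H \<subseteq> E \<Longrightarrow> \<Union>H \<subseteq> V"
  using edge_subset by blast

lemma oriented_edge_arc:
  assumes "{x, y} \<in> E"
  shows "\<exists>g. arc g \<and> pathstart g = p x \<and> pathfinish g = p y \<and> path_image g = path_image (\<gamma> {x, y})"
proof -
  have "pathstart (\<gamma> {x, y}) = p x \<and> pathfinish (\<gamma> {x, y}) = p y \<or>
    pathstart (\<gamma> {x, y}) = p y \<and> pathfinish (\<gamma> {x, y}) = p x"
    using edge_ends[OF assms] by (simp add: doubleton_eq_iff)
  then show ?thesis
  proof
    assume "pathstart (\<gamma> {x, y}) = p x \<and> pathfinish (\<gamma> {x, y}) = p y"
    then show ?thesis using edge_arc[OF assms] by blast
  next
    assume "pathstart (\<gamma> {x, y}) = p y \<and> pathfinish (\<gamma> {x, y}) = p x"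
    then show ?thesis using edge_arc[OF assms]
      by (intro exI[of _ "reversepath (\<gamma> {x, y})"]) (simp add: arc_reversepath)
  qed
qed

text \<open>The arcs of the edges are concatenated; each join is again an arc because the first edge
  meets the rest only in the vertex \<open>y\<close>.\<close>

lemma path_arc:
  assumes "distinct xs" "2 \<le> length xs" "path_edges xs \<subseteq> E"
  shows "\<exists>g. arc g \<and> pathstart g = p (hd xs) \<and> pathfinish g = p (last xs) \<and> path_image g = drawn (path_edges xs)"
  using assms
proof (induction xs rule: path_edges.induct)
  case (1 x y zs)
  obtain g where g: "arc g" "pathstart g = p x" "pathfinish g = p y" "path_image g = path_image (\<gamma> {x, y})"
    using oriented_edge_arc[of x y] 1(4) by auto
  show ?case
  proof (cases zs)
    case Nil
    then show ?thesis using g by (intro exI[of _ g]) (simp add: drawn_def)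
  next
    case (Cons z zs')
    then obtain h where h: "arc h" "pathstart h = p y" "pathfinish h = p (last zs)"
      "path_image h = drawn (path_edges (y # zs))"
      using 1 by auto
    have notin: "{x, y} \<notin> path_edges (y # zs)"
      using path_edges_memD[of "{x, y}" "y # zs" x] 1(2) by auto
    have "path_image g \<inter> path_image h \<subseteq> p ` (\<Union>{{x, y}} \<inter> \<Union>(path_edges (y # zs)))"
      using drawn_Int[of "{{x, y}}" "path_edges (y # zs)"] 1(4) notin g(4) h(4) by (simp add: drawn_def)
    also have "\<dots> \<subseteq> {p y}"
      using Union_path_edges_subset[of "y # zs"] 1(2) by auto
    finally have "arc (g +++ h)" using g h by (intro arc_join) auto
    then show ?thesis
      using g h Cons by (intro exI[of _ "g +++ h"]) (simp add: path_image_join drawn_def)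
  qed
qed auto

lemma ends_drawn:
  assumes "path_edges (v # as @ [w]) \<subseteq> E"
  shows "p v \<in> drawn (path_edges (v # as @ [w]))" "p w \<in> drawn (path_edges (v # as @ [w]))"
proof -
  have U: "\<Union>(path_edges (v # as @ [w])) = set (v # as @ [w])" by (rule Union_path_edges) simp
  then have "set (v # as @ [w]) \<subseteq> V" using Union_subset_V[OF assms] by simp
  then show "p v \<in> drawn (path_edges (v # as @ [w]))" "p w \<in> drawn (path_edges (v # as @ [w]))"
    using vertex_drawn_iff[OF assms] U by auto
qed

lemma paths_meet:
  assumes "distinct (v # as @ w # bs)"
    and "path_edges (v # as @ [w]) \<subseteq> E" "path_edges (v # bs @ [w]) \<subseteq> E"
    and "path_edges (v # as @ [w]) \<inter> path_edges (v # bs @ [w]) = {}"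
  shows "drawn (path_edges (v # as @ [w])) \<inter> drawn (path_edges (v # bs @ [w])) = {p v, p w}"
proof -
  have "\<Union>(path_edges (v # as @ [w])) = set (v # as @ [w])" "\<Union>(path_edges (v # bs @ [w])) = set (v # bs @ [w])"
    by (rule Union_path_edges, simp)+
  then have "\<Union>(path_edges (v # as @ [w])) \<inter> \<Union>(path_edges (v # bs @ [w])) = {v, w}"
    using assms(1) by auto
  then have "drawn (path_edges (v # as @ [w])) \<inter> drawn (path_edges (v # bs @ [w])) \<subseteq> {p v, p w}"
    using drawn_Int[OF assms(2-4)] by simp
  then show ?thesis using ends_drawn[OF assms(2)] ends_drawn[OF assms(3)] by blast
qed

section \<open>Face boundaries and face families\<close>

definition bd :: "complex set \<Rightarrow> 'a set set" where
  "bd R = {e \<in> E. path_image (\<gamma> e) \<subseteq> frontier R}"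

text \<open>An edge outside \<open>C\<close> meets \<open>drawn C\<close> only in its ends, so its
  interior points keep it off the frontier.\<close>

lemma bd_eqI:
  assumes "C \<subseteq> E" "frontier R = drawn C"
  shows "bd R = C"
proof
  show "C \<subseteq> bd R" using assms by (auto simp: bd_def drawn_def)
  show "bd R \<subseteq> C"
  proof
    fix e assume "e \<in> bd R"
    then have e: "e \<in> E" "path_image (\<gamma> e) \<subseteq> drawn C" using assms(2) by (auto simp: bd_def)
    show "e \<in> C"
    proof (rule ccontr)
      assume "e \<notin> C"
      then have "drawn {e} \<inter> drawn C \<subseteq> p ` (\<Union>{e} \<inter> \<Union>C)"
        by (intro drawn_Int) (use e assms(1) in auto)
      then have "path_image (\<gamma> e) \<subseteq> p ` e" using e(2) by (auto simp: drawn_def)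
      then show False
        using nonempty_simple_path_endless[OF arc_imp_simple_path[OF edge_arc[OF e(1)]]] edge_ends[OF e(1)] by blast
    qed
  qed
qed

text \<open>The last clause: both faces of a single cycle have the same boundary, and every ear makes the
  boundaries distinct.\<close>

definition face_family :: "'a set set \<Rightarrow> complex set set \<Rightarrow> bool" where
  "face_family H \<R> \<longleftrightarrow> finite \<R> \<and> (\<forall>R\<in>\<R>. \<forall>S\<in>\<R>. R \<noteq> S \<longrightarrow> R \<inter> S = {}) \<and> \<Union>\<R> = - drawn H \<and>
    (\<forall>R\<in>\<R>. open R \<and> connected R \<and> R \<noteq> {} \<and> bd R \<subseteq> H \<and> (\<exists>n. is_cycle E n (bd R)) \<and> frontier R = drawn (bd R)) \<and>
    (\<forall>e\<in>H. card {R \<in> \<R>. e \<in> bd R} = 2) \<and> card \<R> + card (\<Union>H) = card H + 2 \<and>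
    (inj_on bd \<R> \<or> card \<R> = 2 \<and> (\<forall>R\<in>\<R>. bd R = H))"

text \<open>Base case: the Jordan curve theorem gives two faces, and Euler's formula reads
  \<open>2 + n = n + 2\<close>.\<close>

lemma face_family_cycle:
  assumes C: "is_cycle E n C"
  shows "face_family C {inside (drawn C), outside (drawn C)}"
proof -
  have CE: "C \<subseteq> E" using C by (simp add: is_cycle_def)
  obtain x xs where x: "distinct (x # xs)" "Suc (length xs) = n" "C = path_edges (x # xs @ [x])"
    using C[unfolded is_cycle_iff] by (elim conjE exE)
  have n3: "n \<ge> 3" using C by (simp add: is_cycle_def)
  have UC: "\<Union>C = set (x # xs)" using Union_path_edges[of "x # xs @ [x]"] x(3) by auto
  have "hd xs \<in> set xs" using x(2) n3 by (cases xs) auto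
  \<comment> \<open>The two vertices only serve to present the cycle as two arcs.\<close>
  then have "x \<in> \<Union>C" "hd xs \<in> \<Union>C" "x \<noteq> hd xs" using UC x(1) by auto
  from is_cycle_split[OF C this] obtain as bs where
    d: "distinct (x # as @ hd xs # bs)"
    and Ceq: "C = path_edges (x # as @ [hd xs]) \<union> path_edges (x # bs @ [hd xs])"
    and dj: "path_edges (x # as @ [hd xs]) \<inter> path_edges (x # bs @ [hd xs]) = {}" .
  let ?A = "path_edges (x # as @ [hd xs])" and ?B = "path_edges (x # bs @ [hd xs])"
  have AE: "?A \<subseteq> E" "?B \<subseteq> E" using CE Ceq by auto
  obtain g where g: "arc g" "pathstart g = p x" "pathfinish g = p (hd xs)" "path_image g = drawn ?A"
    using path_arc[of "x # as @ [hd xs]"] d AE by auto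
  obtain h where h: "arc h" "pathstart h = p x" "pathfinish h = p (hd xs)" "path_image h = drawn ?B"
    using path_arc[of "x # bs @ [hd xs]"] d AE by auto
  have int: "path_image g \<inter> path_image h = {p x, p (hd xs)}"
    using paths_meet[OF d AE dj] g(4) h(4) by simp
  have im: "path_image g \<union> path_image h = drawn C" using Ceq g(4) h(4) drawn_Un by simp
  note J = Jordan_arc_pair[OF g(1-3) h(1-3) int, unfolded im]
  have bd: "bd (inside (drawn C)) = C" "bd (outside (drawn C)) = C"
    by (rule bd_eqI[OF CE J(12)], rule bd_eqI[OF CE J(13)])
  have ne: "inside (drawn C) \<noteq> outside (drawn C)" using J(2,10) by (metis Int_absorb)
  have cards: "card (\<Union>C) = n" "card C = n"
    using UC x(1,2) is_cycle_card[OF C] distinct_card[OF x(1)] by auto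
  have "card {R \<in> {inside (drawn C), outside (drawn C)}. e \<in> bd R} = 2" if "e \<in> C" for e
  proof -
    have "{R \<in> {inside (drawn C), outside (drawn C)}. e \<in> bd R} = {inside (drawn C), outside (drawn C)}"
      using bd that by auto
    then show ?thesis using ne by simp
  qed
  then show ?thesis
    unfolding face_family_def using J(2-4,6-8,10-13) bd ne cards C by (auto simp: Int_commute)
qed

end

text \<open>\<open>R\<close> misses the closed curve and so lies in one of its two regions; that
  region is connected and cannot leave \<open>R\<close> without meeting the frontier of
  \<open>R\<close>, which is the curve itself.\<close>

lemma region_of_theta:
  assumes th: "theta c1 c2 c a b" and R: "open R" "connected R" "R \<noteq> {}"
    and fr: "frontier R = path_image c1 \<union> path_image c2"
  shows "R = inside (path_image c1 \<union> path_image c2) \<or> R = outside (path_image c1 \<union> path_image c2)"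
proof -
  interpret theta c1 c2 c a b by fact
  let ?S = "path_image c1 \<union> path_image c2"
  note J = Jordan_arc_pair[OF c1 c2 int12]
  have disj: "R \<inter> ?S = {}" using R(1) fr frontier_disjoint_eq[of R] by (subst Int_commute) simp
  have "R \<subseteq> inside ?S \<union> outside ?S"
    using disj unfolding J(11) disjoint_eq_subset_Compl .
  then have "R \<inter> inside ?S \<noteq> {} \<or> R \<inter> outside ?S \<noteq> {}" using R(3) by blast
  moreover have "R = W" if W: "R \<inter> W \<noteq> {}" "W = inside ?S \<or> W = outside ?S" for W
  proof
    show "R \<subseteq> W" by (rule connected_subset_region[OF R(2) disj W])
    have "connected W" "W \<inter> ?S = {}"
      using W(2) J(4,8) inside_no_overlap[of ?S] outside_no_overlap[of ?S] by metis+
    then have "W - R = {}"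
      using connected_Int_frontier[of W R] W(1) fr unfolding Int_commute[of R] by auto
    then show "W \<subseteq> R" by blast
  qed
  ultimately show ?thesis by metis
qed

context plane_graph
begin

text \<open>The interior of the ear is connected and misses \<open>drawn H\<close>, so it lies in
  one face. Its ends lie on the boundary cycle of that face and cut it into two arcs, which form a
  theta with the ear.\<close>

lemma ear_splits_face:
  assumes ff: "face_family H \<R>" and HE: "H \<subseteq> E"
    and d: "distinct (u # ps @ [w])" and PE: "path_edges (u # ps @ [w]) \<subseteq> E"
    and PH: "path_edges (u # ps @ [w]) \<inter> H = {}"
    and uw: "u \<in> \<Union>H" "w \<in> \<Union>H" and ps: "set ps \<inter> \<Union>H = {}"
  obtains R R1 R2 A B where "R \<in> \<R>" "drawn (path_edges (u # ps @ [w])) \<subseteq> R \<union> drawn H"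
    "open R1 \<and> connected R1 \<and> R1 \<noteq> {} \<and> (\<exists>n. is_cycle E n (bd R1)) \<and> frontier R1 = drawn (bd R1)"
    "open R2 \<and> connected R2 \<and> R2 \<noteq> {} \<and> (\<exists>n. is_cycle E n (bd R2)) \<and> frontier R2 = drawn (bd R2)"
    "R1 \<inter> R2 = {}" "R1 \<union> R2 = R - drawn (path_edges (u # ps @ [w]))"
    "bd R = A \<union> B" "A \<inter> B = {}" "A \<noteq> {}"
    "bd R1 = A \<union> path_edges (u # ps @ [w])" "bd R2 = B \<union> path_edges (u # ps @ [w])"
proof -
  let ?P = "path_edges (u # ps @ [w])"
  note F = ff[unfolded face_family_def]
  from F have disjR: "\<And>R S. R \<in> \<R> \<Longrightarrow> S \<in> \<R> \<Longrightarrow> R \<noteq> S \<Longrightarrow> R \<inter> S = {}"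
    and UR: "\<Union>\<R> = - drawn H"
    and Rprop: "\<And>R. R \<in> \<R> \<Longrightarrow> open R \<and> connected R \<and> R \<noteq> {} \<and> bd R \<subseteq> H \<and> (\<exists>n. is_cycle E n (bd R)) \<and> frontier R = drawn (bd R)"
    by (elim conjE; blast)+
  obtain g where g: "arc g" "pathstart g = p u" "pathfinish g = p w" "path_image g = drawn ?P"
    using path_arc[OF d _ PE] by (auto simp del: path_edges.simps)
  have UP: "\<Union>?P = set (u # ps @ [w])" by (rule Union_path_edges) simp
  have uV: "u \<in> V" "w \<in> V" using UP Union_subset_V[OF PE] by auto
  have meet: "path_image g \<inter> drawn H \<subseteq> {p u, p w}"
  proof -
    have "\<Union>?P \<inter> \<Union>H \<subseteq> {u, w}" using UP ps by auto
    then have "p ` (\<Union>?P \<inter> \<Union>H) \<subseteq> p ` {u, w}" by (rule image_mono)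
    then show ?thesis using subset_trans[OF drawn_Int[OF PE HE PH]] g(4) by simp
  qed
  have pH: "p u \<in> drawn H" "p w \<in> drawn H" using vertex_drawn_iff[OF HE] uV uw by auto
  define I where "I = path_image g - {p u, p w}"
  have I: "connected I" "I \<noteq> {}"
    using connected_simple_path_endless[OF arc_imp_simple_path[OF g(1)]]
      nonempty_simple_path_endless[OF arc_imp_simple_path[OF g(1)]] g(2,3) by (simp_all add: I_def)
  have IR: "I \<subseteq> \<Union>\<R>" unfolding UR I_def using meet by blast
  obtain R where R: "R \<in> \<R>" "I \<inter> R \<noteq> {}" using I(2) IR by blast
  have I_sub: "I \<subseteq> R"
    by (rule connected_in_disjoint_open_family[OF I(1) IR _ R]) (use Rprop disjR R(1) in metis)+
  note RR = Rprop[OF R(1)]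
  have bdE: "bd R \<subseteq> E" by (auto simp: bd_def)
  have gcl: "path_image g \<subseteq> closure R"
    using arc_ends_in_closure_endless[OF g(1)] closure_mono[OF I_sub] g(2,3) by (auto simp: I_def)
  have RH: "R \<inter> drawn H = {}" using UR R(1) by blast
  \<comment> \<open>A point of \<open>drawn H\<close> that is a limit of \<open>R\<close> is not in
    \<open>R\<close>, hence on the frontier, which is the drawn boundary cycle.\<close>
  have "v \<in> \<Union>(bd R)" if "v \<in> V" "p v \<in> path_image g" "p v \<in> drawn H" for v
  proof -
    have "p v \<in> closure R - interior R"
      using gcl that(2,3) RH interior_subset[of R] by blast
    then have "p v \<in> drawn (bd R)" using RR unfolding frontier_def by metis
    then show ?thesis using vertex_drawn_iff[OF bdE that(1)] by simp
  qed
  then have "u \<in> \<Union>(bd R)" "w \<in> \<Union>(bd R)"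
    using uV pH g pathstart_in_path_image[of g] pathfinish_in_path_image[of g] by simp_all
  moreover have "u \<noteq> w" using d by auto
  moreover obtain n where n: "is_cycle E n (bd R)" using RR by blast
  ultimately obtain as bs where ab: "distinct (u # as @ w # bs)"
    and bdR: "bd R = path_edges (u # as @ [w]) \<union> path_edges (u # bs @ [w])"
    and djAB: "path_edges (u # as @ [w]) \<inter> path_edges (u # bs @ [w]) = {}"
    using is_cycle_split by metis
  let ?A = "path_edges (u # as @ [w])" and ?B = "path_edges (u # bs @ [w])"
  have ABE: "?A \<subseteq> E" "?B \<subseteq> E" and ABH: "?A \<subseteq> H" "?B \<subseteq> H" using bdE bdR RR by auto
  have UAB: "\<Union>?A = set (u # as @ [w])" "\<Union>?B = set (u # bs @ [w])"
    by (rule Union_path_edges, simp)+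
  have "\<Union>?A \<subseteq> \<Union>H" "\<Union>?B \<subseteq> \<Union>H" using ABH by (intro Union_mono; simp)+
  then have "set as \<inter> set ps = {}" "set bs \<inter> set ps = {}" using ps unfolding UAB by auto
  then have dAP: "distinct (u # as @ w # ps)" and dBP: "distinct (u # bs @ w # ps)" using ab d by auto
  obtain c1 where c1: "arc c1" "pathstart c1 = p u" "pathfinish c1 = p w" "path_image c1 = drawn ?A"
    using path_arc[of "u # as @ [w]"] ab ABE by auto
  obtain c2 where c2: "arc c2" "pathstart c2 = p u" "pathfinish c2 = p w" "path_image c2 = drawn ?B"
    using path_arc[of "u # bs @ [w]"] ab ABE by auto
  have djP: "?A \<inter> ?P = {}" "?B \<inter> ?P = {}" using ABH PH by auto
  have th: "theta c1 c2 g (p u) (p w)"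
    unfolding theta_def c1(4) c2(4) g(4)
    using c1(1-3) c2(1-3) g(1-3) paths_meet[OF ab ABE djAB] paths_meet[OF dAP ABE(1) PE djP(1)]
      paths_meet[OF dBP ABE(2) PE djP(2)] by simp
  have fr: "frontier R = path_image c1 \<union> path_image c2"
    using RR bdR c1(4) c2(4) drawn_Un by simp
  have "region_split R (path_image c1) (path_image c2) (path_image g)"
    by (rule theta_split[OF th region_of_theta[OF th _ _ _ fr]]) (use RR I_sub in \<open>auto simp: I_def\<close>)
  then obtain R1 R2 where S: "open R1" "connected R1" "R1 \<noteq> {}" "open R2" "connected R2" "R2 \<noteq> {}"
    "R1 \<inter> R2 = {}" "R1 \<union> R2 = R - drawn ?P"
    "frontier R1 = drawn (?A \<union> ?P)" "frontier R2 = drawn (?B \<union> ?P)"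
    unfolding region_split_def c1(4) c2(4) g(4) drawn_Un by (elim exE conjE)
  have bd1: "bd R1 = ?A \<union> ?P" using S(9) ABE PE by (intro bd_eqI) auto
  have bd2: "bd R2 = ?B \<union> ?P" using S(10) ABE PE by (intro bd_eqI) auto
  \<comment> \<open>An arc and an ear without inner vertices would be the same edge, but the ear
    avoids \<open>H\<close>; so both new boundaries are genuine cycles.\<close>
  have not_both: "as = [] \<Longrightarrow> ps = [] \<Longrightarrow> False" "bs = [] \<Longrightarrow> ps = [] \<Longrightarrow> False"
    using djP by auto
  have cyc1: "\<exists>n. is_cycle E n (bd R1)" unfolding bd1
    using is_cycle_join[OF dAP] not_both(1) ABE PE by blast
  have cyc2: "\<exists>n. is_cycle E n (bd R2)" unfolding bd2
    using is_cycle_join[OF dBP] not_both(2) ABE PE by blast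
  have Ane: "?A \<noteq> {}" by (cases as) auto
  have cover: "drawn ?P \<subseteq> R \<union> drawn H" using I_sub pH g(4) unfolding I_def by blast
  show ?thesis
    by (rule that[OF R(1) cover _ _ S(7,8) bdR djAB Ane bd1 bd2])
      (use S(1-6,9,10) cyc1 cyc2 bd1 bd2 in metis)+
qed

text \<open>The split face is replaced by its two parts. The ear contributes one face,
  \<open>length ps\<close> vertices and \<open>length ps + 1\<close> edges, so Euler's formula
  persists.\<close>

lemma face_family_ear:
  assumes ff: "face_family H \<R>" and HE: "H \<subseteq> E"
    and d: "distinct (u # ps @ [w])" and PE: "path_edges (u # ps @ [w]) \<subseteq> E"
    and PH: "path_edges (u # ps @ [w]) \<inter> H = {}"
    and uw: "u \<in> \<Union>H" "w \<in> \<Union>H" and ps: "set ps \<inter> \<Union>H = {}"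
  shows "\<exists>\<R>'. face_family (H \<union> path_edges (u # ps @ [w])) \<R>'"
proof -
  let ?P = "path_edges (u # ps @ [w])"
  note F = ff[unfolded face_family_def]
  from F have finR: "finite \<R>" and disjR: "\<And>R S. R \<in> \<R> \<Longrightarrow> S \<in> \<R> \<Longrightarrow> R \<noteq> S \<Longrightarrow> R \<inter> S = {}"
    and UR: "\<Union>\<R> = - drawn H"
    and Rprop: "\<And>R. R \<in> \<R> \<Longrightarrow> open R \<and> connected R \<and> R \<noteq> {} \<and> bd R \<subseteq> H \<and> (\<exists>n. is_cycle E n (bd R)) \<and> frontier R = drawn (bd R)"
    and two: "\<And>e. e \<in> H \<Longrightarrow> card {R \<in> \<R>. e \<in> bd R} = 2"
    and euler: "card \<R> + card (\<Union>H) = card H + 2"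
    and injbd: "inj_on bd \<R> \<or> card \<R> = 2 \<and> (\<forall>R\<in>\<R>. bd R = H)"
    by (elim conjE; blast)+
  have bdH: "bd S \<subseteq> H" if "S \<in> \<R>" for S using Rprop[OF that] by (elim conjE)
  have UP: "\<Union>?P = set (u # ps @ [w])" by (rule Union_path_edges) simp
  obtain R R1 R2 A B where R: "R \<in> \<R>" and cover: "drawn ?P \<subseteq> R \<union> drawn H"
    and R1: "open R1 \<and> connected R1 \<and> R1 \<noteq> {} \<and> (\<exists>n. is_cycle E n (bd R1)) \<and> frontier R1 = drawn (bd R1)"
    and R2: "open R2 \<and> connected R2 \<and> R2 \<noteq> {} \<and> (\<exists>n. is_cycle E n (bd R2)) \<and> frontier R2 = drawn (bd R2)"
    and dj: "R1 \<inter> R2 = {}" and un: "R1 \<union> R2 = R - drawn ?P"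
    and bdR: "bd R = A \<union> B" and djAB: "A \<inter> B = {}" and Ane: "A \<noteq> {}"
    and bd1: "bd R1 = A \<union> ?P" and bd2: "bd R2 = B \<union> ?P"
    using ear_splits_face[OF assms] .
  have ABH: "A \<subseteq> H" "B \<subseteq> H" using bdH[OF R] unfolding bdR by auto
  have sub: "R1 \<subseteq> R" "R2 \<subseteq> R" using un by auto
  have new: "S' \<inter> R1 = {}" "S' \<inter> R2 = {}" if "S' \<in> \<R> - {R}" for S'
    using disjR[of S' R] that R sub by auto
  have notin: "R1 \<notin> \<R> - {R}" "R2 \<notin> \<R> - {R}" "R1 \<noteq> R2" using new R1 R2 dj by auto
  define \<R>' where "\<R>' = insert R1 (insert R2 (\<R> - {R}))"
  have pos: "card \<R> > 0" using finR R card_gt_0_iff by blast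
  have card': "card \<R>' = card \<R> + 1"
    using finR R notin pos unfolding \<R>'_def by (simp add: card_Diff_singleton)
  have Pne: "{u, hd (ps @ [w])} \<in> ?P" by (cases ps) auto
  then have Pne: "?P \<noteq> {}" by blast
  show ?thesis
  proof (rule exI[of _ \<R>'], unfold face_family_def, intro conjI)
    show "finite \<R>'" using finR by (simp add: \<R>'_def)
    show "\<forall>R\<in>\<R>'. \<forall>S\<in>\<R>'. R \<noteq> S \<longrightarrow> R \<inter> S = {}"
    proof (intro ballI impI)
      fix X Y assume XY: "X \<in> \<R>'" "Y \<in> \<R>'" "X \<noteq> Y"
      show "X \<inter> Y = {}"
        using XY new[of X] new[of Y] disjR[of X Y] dj unfolding \<R>'_def
        by (metis DiffD1 Int_commute insertE)
    qed
    \<comment> \<open>The ear lies in \<open>R \<union> drawn H\<close>, so no other face loses a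
      point.\<close>
    have "\<Union>\<R> = R \<union> \<Union>(\<R> - {R})" using R by blast
    moreover have "\<Union>(\<R> - {R}) \<inter> drawn ?P = {}"
    proof -
      have "\<Union>(\<R> - {R}) \<inter> R = {}" using disjR R by blast
      moreover have "\<Union>(\<R> - {R}) \<inter> drawn H = {}" using UR by blast
      ultimately show ?thesis using cover by blast
    qed
    moreover have "\<Union>\<R>' = R - drawn ?P \<union> \<Union>(\<R> - {R})" unfolding \<R>'_def using un by auto
    moreover have "X = - (D \<union> Q)" if "- D = R \<union> U" "U \<inter> Q = {}" "X = R - Q \<union> U" for X D Q U :: "complex set"
      using that by blast
    ultimately show "\<Union>\<R>' = - drawn (H \<union> ?P)" using UR unfolding drawn_Un by metis
    show "\<forall>R\<in>\<R>'. open R \<and> connected R \<and> R \<noteq> {} \<and> bd R \<subseteq> H \<union> ?P \<and>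
      (\<exists>n. is_cycle E n (bd R)) \<and> frontier R = drawn (bd R)"
    proof
      fix X assume "X \<in> \<R>'"
      then consider "X = R1" | "X = R2" | "X \<in> \<R>" unfolding \<R>'_def by blast
      then show "open X \<and> connected X \<and> X \<noteq> {} \<and> bd X \<subseteq> H \<union> ?P \<and>
        (\<exists>n. is_cycle E n (bd X)) \<and> frontier X = drawn (bd X)"
      proof cases
        case 1
        have "bd R1 \<subseteq> H \<union> ?P" unfolding bd1 using ABH by blast
        then show ?thesis using 1 R1 by simp
      next
        case 2
        have "bd R2 \<subseteq> H \<union> ?P" unfolding bd2 using ABH by blast
        then show ?thesis using 2 R2 by simp
      next
        case 3
        then show ?thesis using Rprop[OF 3] by (meson le_supI1)
      qed
    qed
    show "\<forall>e\<in>H \<union> ?P. card {R \<in> \<R>'. e \<in> bd R} = 2"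
    proof
      fix e assume e: "e \<in> H \<union> ?P"
      show "card {R \<in> \<R>'. e \<in> bd R} = 2"
      proof (cases "e \<in> ?P")
        case True
        then have "e \<notin> bd X" if "X \<in> \<R>" for X
          using subsetD[OF bdH[OF that]] disjoint_iff[THEN iffD1, OF PH] by metis
        moreover have "e \<in> bd R1" "e \<in> bd R2" using True unfolding bd1 bd2 by simp_all
        ultimately have "{R \<in> \<R>'. e \<in> bd R} = {R1, R2}" unfolding \<R>'_def by blast
        then show ?thesis using notin(3) by simp
      next
        case False
        then have eH: "e \<in> H" using e by blast
        let ?Q = "{S \<in> \<R>. e \<in> bd S}"
        have finQ: "finite ?Q" using finR by simp
        show ?thesis
        proof (cases "e \<in> bd R")
          case eR: True
          \<comment> \<open>A boundary edge of \<open>R\<close> passes to exactly one of the two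
            parts, so it keeps its number of faces.\<close>
          have "\<exists>X. X \<notin> \<R> - {R} \<and> {R \<in> \<R>'. e \<in> bd R} = insert X (?Q - {R})"
          proof (cases "e \<in> A")
            case True
            then have "e \<notin> B" using disjoint_iff[THEN iffD1, OF djAB] by simp
            then have "e \<in> bd R1" "e \<notin> bd R2" using True False unfolding bd1 bd2 by simp_all
            then have "{R \<in> \<R>'. e \<in> bd R} = insert R1 (?Q - {R})" unfolding \<R>'_def by blast
            then show ?thesis by (intro exI[of _ R1] conjI notin(1))
          next
            case nA: False
            then have "e \<in> B" using bdR eR by simp
            then have "e \<notin> bd R1" "e \<in> bd R2" using nA False unfolding bd1 bd2 by simp_all
            then have "{R \<in> \<R>'. e \<in> bd R} = insert R2 (?Q - {R})" unfolding \<R>'_def by blast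
            then show ?thesis by (intro exI[of _ R2] conjI notin(2))
          qed
          then obtain X where X: "X \<notin> \<R> - {R}" "{R \<in> \<R>'. e \<in> bd R} = insert X (?Q - {R})" by blast
          have "X \<notin> ?Q - {R}" using X(1) by blast
          then have "card (insert X (?Q - {R})) = Suc (card (?Q - {R}))"
            by (intro card_insert_disjoint finite_Diff finQ)
          also have "\<dots> = card ?Q" by (intro card_Suc_Diff1 finQ) (use R eR in simp)
          finally have "card (insert X (?Q - {R})) = card ?Q" .
          then show ?thesis using X(2) two[OF eH] by simp
        next
          case nR: False
          then have "e \<notin> A" "e \<notin> B" using bdR by auto
          then have "e \<notin> bd R1" "e \<notin> bd R2" using False unfolding bd1 bd2 by simp_all
          then have "{R \<in> \<R>'. e \<in> bd R} = ?Q" using nR unfolding \<R>'_def by blast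
          then show ?thesis using two[OF eH] by simp
        qed
      qed
    qed
    have finH: "finite H" "finite (\<Union>H)"
      by (rule finite_subset[OF HE finite_edges], rule finite_subset[OF Union_subset_V[OF HE] finite_vertices])
    have "card (H \<union> ?P) = card H + card ?P"
      by (rule card_Un_disjoint[OF finH(1) finite_path_edges]) (use PH in blast)
    moreover have "card ?P = length ps + 1" using card_path_edges[OF d] by simp
    moreover have "card (\<Union>(H \<union> ?P)) = card (\<Union>H) + length ps"
    proof -
      have "\<Union>(H \<union> ?P) = \<Union>H \<union> set ps" using UP uw by auto
      moreover have "card (\<Union>H \<union> set ps) = card (\<Union>H) + card (set ps)"
        by (rule card_Un_disjoint[OF finH(2) finite_set]) (use ps in blast)
      moreover have "card (set ps) = length ps" using d by (intro distinct_card) simp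
      ultimately show ?thesis by simp
    qed
    ultimately show "card \<R>' + card (\<Union>(H \<union> ?P)) = card (H \<union> ?P) + 2"
      using euler card' by simp
    \<comment> \<open>The new boundaries contain ear edges, which no old boundary does; they differ
      from each other because \<open>A\<close> is nonempty and disjoint from
      \<open>B\<close>.\<close>
    have "inj_on bd \<R>'"
    proof -
      have AB: "bd R1 \<noteq> bd R2"
      proof
        assume "bd R1 = bd R2"
        then have "A \<union> ?P = B \<union> ?P" unfolding bd1 bd2 .
        then have "A \<subseteq> B" using ABH PH by blast
        then show False using djAB Ane by blast
      qed
      have old: "bd R1 \<noteq> bd X" "bd R2 \<noteq> bd X" if "X \<in> \<R>" for X
      proof -
        obtain e where "e \<in> ?P" using Pne by blast
        then have "e \<in> bd R1" "e \<in> bd R2" "e \<notin> bd X"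
          using subsetD[OF bdH[OF that]] disjoint_iff[THEN iffD1, OF PH] unfolding bd1 bd2 by auto
        then show "bd R1 \<noteq> bd X" "bd R2 \<noteq> bd X" by blast+
      qed
      \<comment> \<open>If \<open>H\<close> was a single cycle with two equal boundaries, only one
        old face remains.\<close>
      have "inj_on bd (\<R> - {R})"
        using injbd
      proof
        assume "card \<R> = 2 \<and> (\<forall>R\<in>\<R>. bd R = H)"
        then have "card (\<R> - {R}) = 1" using R finR by simp
        then obtain Y where "\<R> - {R} = {Y}" by (rule card_1_singletonE)
        then show ?thesis by simp
      qed (simp add: inj_on_diff)
      then show ?thesis
        unfolding \<R>'_def inj_on_insert using AB old by blast
    qed
    then show "inj_on bd \<R>' \<or> card \<R>' = 2 \<and> (\<forall>R\<in>\<R>'. bd R = H \<union> ?P)" ..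
  qed
qed

end

section \<open>Short cycles near triangles\<close>

text \<open>Condition (i); \<open>nonadjacent_triangles\<close> is condition (ii).\<close>

definition separated_triangles :: "'a set set \<Rightarrow> bool" where
  "separated_triangles E \<longleftrightarrow>
     (\<forall>T T'. is_triangle E T \<and> is_triangle E T' \<longrightarrow> \<not> intersecting_cycles T T') \<and>
     (\<forall>T. is_triangle E T \<longrightarrow> card {Q. is_cycle E 4 Q \<and> adjacent_cycles T Q} \<le> 1)"

definition nonadjacent_triangles :: "'a set set \<Rightarrow> bool" where
  "nonadjacent_triangles E \<longleftrightarrow>
     (\<forall>T C. is_triangle E T \<and> (is_triangle E C \<or> is_cycle E 4 C) \<longrightarrow> \<not> adjacent_cycles T C) \<and>
     (\<forall>P. is_cycle E 5 P \<longrightarrow> card {T. is_triangle E T \<and> adjacent_cycles P T} \<le> 3)"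

lemma finite_cycles: "finite E \<Longrightarrow> finite {C. is_cycle E n C \<and> P C}"
  by (rule finite_subset[of _ "Pow E"]) (auto simp: is_cycle_def)

text \<open>A subgraph has no new cycles. Finiteness enters through the counting clause, since
  \<open>card\<close> is 0 on infinite sets.\<close>

lemma separated_triangles_mono:
  assumes "separated_triangles E" "F \<subseteq> E" "finite E"
  shows "separated_triangles F"
  unfolding separated_triangles_def
proof (intro conjI allI impI)
  fix T T' assume "is_triangle F T \<and> is_triangle F T'"
  then show "\<not> intersecting_cycles T T'"
    using assms(1,2) is_cycle_mono unfolding separated_triangles_def by metis
next
  fix T assume T: "is_triangle F T"
  have "card {Q. is_cycle F 4 Q \<and> adjacent_cycles T Q} \<le> card {Q. is_cycle E 4 Q \<and> adjacent_cycles T Q}"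
    by (rule card_mono[OF finite_cycles[OF assms(3)]]) (use assms(2) is_cycle_mono in blast)
  also have "\<dots> \<le> 1" using assms(1,2) T is_cycle_mono unfolding separated_triangles_def by metis
  finally show "card {Q. is_cycle F 4 Q \<and> adjacent_cycles T Q} \<le> 1" .
qed

lemma nonadjacent_triangles_mono:
  assumes "nonadjacent_triangles E" "F \<subseteq> E" "finite E"
  shows "nonadjacent_triangles F"
  unfolding nonadjacent_triangles_def
proof (intro conjI allI impI)
  fix T C assume "is_triangle F T \<and> (is_triangle F C \<or> is_cycle F 4 C)"
  then show "\<not> adjacent_cycles T C"
    using assms(1,2) is_cycle_mono unfolding nonadjacent_triangles_def by metis
next
  fix P assume P: "is_cycle F 5 P"
  have "card {T. is_triangle F T \<and> adjacent_cycles P T} \<le> card {T. is_triangle E T \<and> adjacent_cycles P T}"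
    by (rule card_mono[OF finite_cycles[OF assms(3)]]) (use assms(2) is_cycle_mono in blast)
  also have "\<dots> \<le> 3" using assms(1,2) P is_cycle_mono unfolding nonadjacent_triangles_def by metis
  finally show "card {T. is_triangle F T \<and> adjacent_cycles P T} \<le> 3" .
qed

section \<open>Vertex lists adapted to given edges of a cycle\<close>

lemma is_cycle_edge:
  assumes C: "is_cycle E n C" and e: "{x, y} \<in> C"
  obtains xs where "distinct (y # xs)" "Suc (length xs) = n" "C = path_edges (y # xs @ [y])" "last xs = x"
proof -
  have "y \<in> \<Union>C" using e by blast
  then obtain xs where xs: "distinct (y # xs)" "Suc (length xs) = n" "C = path_edges (y # xs @ [y])"
    by (rule is_cycle_rotate[OF C])
  have len: "2 \<le> length xs" using xs(2) C by (simp add: is_cycle_def)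
  have "{x, y} = {y, hd xs} \<or> {x, y} = {y, last xs}"
    by (rule closed_path_edges_at[OF xs(1) len]) (use e xs(3) in auto)
  moreover have "x \<noteq> y"
  proof
    assume "x = y"
    then have "y = hd xs \<or> y = last xs" using calculation by (auto simp: doubleton_eq_iff)
    then show False using xs(1) len by (cases xs) (auto split: if_splits)
  qed
  ultimately have "x = hd xs \<or> x = last xs" by (auto simp: doubleton_eq_iff)
  then show ?thesis
  proof
    assume "x = last xs"
    then show ?thesis using that xs by blast
  next
    assume "x = hd xs"
    then have "last (rev xs) = x" using len by (cases xs) auto
    moreover have "C = path_edges (y # rev xs @ [y])"
      using path_edges_rev[of "y # xs @ [y]"] xs(3) by simp
    ultimately show ?thesis using that[of "rev xs"] xs by simp
  qed
qed

text \<open>The list starts at the common vertex of two consecutive edges, so that a short cycle can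
  be written out explicitly.\<close>

lemma is_cycle_two_edges:
  assumes C: "is_cycle E n C" and e: "{a, b} \<in> C" "{b, c} \<in> C" "a \<noteq> c"
  obtains ys where "distinct (b # c # ys @ [a])" "length ys + 3 = n" "C = path_edges (b # c # ys @ [a, b])"
proof -
  obtain xs where xs: "distinct (b # xs)" "Suc (length xs) = n" "C = path_edges (b # xs @ [b])" "last xs = a"
    by (rule is_cycle_edge[OF C e(1)])
  have len: "2 \<le> length xs" using xs(2) C by (simp add: is_cycle_def)
  have "{b, c} = {b, hd xs} \<or> {b, c} = {b, last xs}"
    by (rule closed_path_edges_at[OF xs(1) len]) (use e xs(3) in auto)
  then have c: "c = hd xs" using e(3) xs(4) by (auto simp: doubleton_eq_iff)
  obtain z zs where z: "xs = z # zs" using len by (cases xs) auto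
  then have "zs \<noteq> []" using len by auto
  then obtain ys where "zs = ys @ [a]" using xs(4) z by (cases zs rule: rev_exhaust) auto
  then show ?thesis using that[of ys] xs z c by simp
qed

lemma length_1_2_conv: "length xs = Suc 0 \<longleftrightarrow> (\<exists>d. xs = [d])" "length xs = Suc (Suc 0) \<longleftrightarrow> (\<exists>d e. xs = [d, e])"
  by (auto simp: length_Suc_conv)

lemma triangle_two_edges:
  assumes T: "is_triangle E T" and e: "{a, b} \<in> T" "{b, c} \<in> T" "a \<noteq> c"
  shows "distinct [a, b, c]" "T = {{a, b}, {b, c}, {c, a}}" "T \<subseteq> E"
proof -
  obtain ys where ys: "distinct (b # c # ys @ [a])" "length ys + 3 = 3" "T = path_edges (b # c # ys @ [a, b])"
    by (rule is_cycle_two_edges[OF T e])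
  then show "distinct [a, b, c]" "T = {{a, b}, {b, c}, {c, a}}" by auto
  show "T \<subseteq> E" using T by (simp add: is_cycle_def)
qed

lemma four_cycle_two_edges:
  assumes Q: "is_cycle E 4 Q" and e: "{a, b} \<in> Q" "{b, c} \<in> Q" "a \<noteq> c"
  obtains d where "distinct [a, b, c, d]" "Q = {{a, b}, {b, c}, {c, d}, {d, a}}" "Q \<subseteq> E"
proof -
  obtain ys where ys: "distinct (b # c # ys @ [a])" "length ys + 3 = 4" "Q = path_edges (b # c # ys @ [a, b])"
    by (rule is_cycle_two_edges[OF Q e])
  then obtain d where d: "ys = [d]" by (auto simp: length_1_2_conv)
  have "Q \<subseteq> E" using Q by (simp add: is_cycle_def)
  moreover have "Q = {{a, b}, {b, c}, {c, d}, {d, a}}" using ys(3) d by auto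
  ultimately show ?thesis using that[of d] ys(1) d by auto
qed

lemma five_cycle_two_edges:
  assumes C: "is_cycle E 5 C" and e: "{a, b} \<in> C" "{b, c} \<in> C" "a \<noteq> c"
  obtains d d' where "distinct [a, b, c, d, d']" "C = {{a, b}, {b, c}, {c, d}, {d, d'}, {d', a}}" "C \<subseteq> E"
proof -
  obtain ys where ys: "distinct (b # c # ys @ [a])" "length ys + 3 = 5" "C = path_edges (b # c # ys @ [a, b])"
    by (rule is_cycle_two_edges[OF C e])
  then have "length ys = Suc (Suc 0)" by simp
  then obtain d d' where d: "ys = [d, d']" by (auto simp only: length_1_2_conv)
  have "C \<subseteq> E" using C by (simp add: is_cycle_def)
  moreover have "C = {{a, b}, {b, c}, {c, d}, {d, d'}, {d', a}}" using ys(3) d by auto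
  ultimately show ?thesis using that[of d d'] ys(1) d by auto
qed

lemma triangle_edges_meet:
  assumes "is_triangle E T" "e \<in> T" "f \<in> T" "e \<noteq> f"
  obtains a b c where "e = {a, b}" "f = {b, c}" "a \<noteq> c"
proof -
  obtain x y z where T: "distinct [x, y, z]" "T = {{x, y}, {y, z}, {z, x}}"
    using assms(1) unfolding is_cycle_3_iff by blast
  have "\<exists>a b c. e = {a, b} \<and> f = {b, c} \<and> a \<noteq> c"
  proof -
    have chain: "\<exists>a b c. e = {a, b} \<and> f = {b, c} \<and> a \<noteq> c" if "e = {p, q} \<and> f = {q, r}" "p \<noteq> r" for p q r
      using that by blast
    have "e = {x, y} \<and> f = {y, z} \<or> e = {y, x} \<and> f = {x, z} \<or> e = {z, y} \<and> f = {y, x}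
      \<or> e = {y, z} \<and> f = {z, x} \<or> e = {z, x} \<and> f = {x, y} \<or> e = {x, z} \<and> f = {z, y}"
    proof -
      have "e = {x, y} \<or> e = {y, z} \<or> e = {z, x}" "f = {x, y} \<or> f = {y, z} \<or> f = {z, x}"
        using assms(2,3) T(2) by simp_all
      then show ?thesis using assms(4) by (elim disjE) (simp_all add: insert_commute)
    qed
    then show ?thesis using T(1) by (elim disjE) (rule chain, assumption, force)+
  qed
  then show ?thesis using that by blast
qed

lemma separated_triangles_eq:
  assumes "separated_triangles E" "is_triangle E T" "is_triangle E T'" "e \<in> T" "f \<in> T'" "v \<in> e" "v \<in> f"
  shows "T = T'"
proof -
  have "v \<in> \<Union>T" "v \<in> \<Union>T'" using assms(4-7) by auto
  moreover have "\<not> intersecting_cycles T T'" using assms(1-3) by (simp add: separated_triangles_def)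
  ultimately show ?thesis unfolding intersecting_cycles_def by (metis IntI empty_iff)
qed

text \<open>With two common edges \<open>ab\<close> and \<open>bc\<close>, the third side
  \<open>ca\<close> would be a chord of the 4-cycle and cut off a second triangle \<open>acd\<close>
  through \<open>a\<close>.\<close>

lemma triangle_four_cycle:
  assumes sep: "separated_triangles E" and T: "is_triangle E T" and Q: "is_cycle E 4 Q"
    and e: "e \<in> T" "e \<in> Q" and f: "f \<in> T" "f \<in> Q"
  shows "e = f"
proof (rule ccontr)
  assume "e \<noteq> f"
  then obtain a b c where abc: "e = {a, b}" "f = {b, c}" "a \<noteq> c"
    by (rule triangle_edges_meet[OF T e(1) f(1)])
  have TT: "distinct [a, b, c]" "T = {{a, b}, {b, c}, {c, a}}" "T \<subseteq> E"
    by (rule triangle_two_edges[OF T e(1)[unfolded abc(1)] f(1)[unfolded abc(2)] abc(3)])+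
  obtain d where d: "distinct [a, b, c, d]" "Q = {{a, b}, {b, c}, {c, d}, {d, a}}" "Q \<subseteq> E"
    by (rule four_cycle_two_edges[OF Q e(2)[unfolded abc(1)] f(2)[unfolded abc(2)] abc(3)])
  have "is_triangle E {{a, c}, {c, d}, {d, a}}"
    unfolding is_cycle_3_iff using TT d by (intro exI[of _ a] exI[of _ c] exI[of _ d]) (auto simp: insert_commute)
  then have "T = {{a, c}, {c, d}, {d, a}}"
    by (rule separated_triangles_eq[OF sep T, of _ "{a, b}" "{a, c}" a]) (use TT in auto)
  then have "{c, d} \<in> T" by simp
  then show False using TT(2) d(1) by (auto simp: doubleton_eq_iff)
qed

text \<open>For a 5-cycle through \<open>a\<close>, \<open>b\<close>, \<open>c\<close>,
  \<open>d\<close>, \<open>d'\<close>: the side \<open>ac\<close> of a triangle replaces the path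
  through \<open>b\<close> and leaves a 4-cycle adjacent to the triangle.\<close>

lemma shortcut_four_cycle:
  assumes "distinct [a, b, c, d, d']" "is_triangle E T" "{c, a} \<in> T"
    and "{{c, d}, {d, d'}, {d', a}} \<subseteq> E"
  shows "is_cycle E 4 {{a, c}, {c, d}, {d, d'}, {d', a}}" "adjacent_cycles T {{a, c}, {c, d}, {d, d'}, {d', a}}"
proof -
  have "T \<subseteq> E" using assms(2) by (simp add: is_cycle_def)
  then show Q: "is_cycle E 4 {{a, c}, {c, d}, {d, d'}, {d', a}}"
    by (intro is_cycle_4I) (use assms in \<open>auto simp: insert_commute\<close>)
  have "T \<noteq> {{a, c}, {c, d}, {d, d'}, {d', a}}"
    using is_cycle_card[OF Q] is_cycle_card[OF assms(2)] by auto
  then show "adjacent_cycles T {{a, c}, {c, d}, {d, d'}, {d', a}}"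
    unfolding adjacent_cycles_def using assms(3) by (auto simp: insert_commute)
qed

text \<open>Two common edges would give the shortcut 4-cycle, which shares the third side with the
  triangle, against (ii).\<close>

lemma triangle_five_cycle:
  assumes na: "nonadjacent_triangles E" and T: "is_triangle E T" and C: "is_cycle E 5 C"
    and e: "e \<in> T" "e \<in> C" and f: "f \<in> T" "f \<in> C"
  shows "e = f"
proof (rule ccontr)
  assume "e \<noteq> f"
  then obtain a b c where abc: "e = {a, b}" "f = {b, c}" "a \<noteq> c"
    by (rule triangle_edges_meet[OF T e(1) f(1)])
  have TT: "distinct [a, b, c]" "T = {{a, b}, {b, c}, {c, a}}" "T \<subseteq> E"
    by (rule triangle_two_edges[OF T e(1)[unfolded abc(1)] f(1)[unfolded abc(2)] abc(3)])+
  obtain d d' where d: "distinct [a, b, c, d, d']" "C = {{a, b}, {b, c}, {c, d}, {d, d'}, {d', a}}" "C \<subseteq> E"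
    by (rule five_cycle_two_edges[OF C e(2)[unfolded abc(1)] f(2)[unfolded abc(2)] abc(3)])
  have "{c, a} \<in> T" "{{c, d}, {d, d'}, {d', a}} \<subseteq> E" using TT(2) d(2,3) by simp_all
  note Q = shortcut_four_cycle[OF d(1) T this]
  have "\<forall>C. is_cycle E 4 C \<longrightarrow> \<not> adjacent_cycles T C"
    using na T by (simp add: nonadjacent_triangles_def)
  then show False using Q by metis
qed

section \<open>Discharging\<close>

text \<open>Only counting remains here. Faces are given by their boundary edge sets, which
  presupposes that distinct faces have distinct boundaries.\<close>

locale face_system =
  fixes E :: "'a set set" and \<F> :: "'a set set set"
  assumes fin: "finite E"
    and cycles: "C \<in> \<F> \<Longrightarrow> \<exists>n. is_cycle E n C"
    and two_faces: "e \<in> E \<Longrightarrow> card {C \<in> \<F>. e \<in> C} = 2"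
begin

text \<open>Only the triangles bounding faces, whereas the hypotheses concern all triangles of the
  graph.\<close>

definition triangles :: "'a set set set" where "triangles = {C \<in> \<F>. card C = 3}"
definition big_faces :: "'a set set set" where "big_faces = {C \<in> \<F>. 5 \<le> card C}"
definition tri_edges :: "'a set set" where "tri_edges = \<Union>triangles"
definition big_edges :: "'a set set" where "big_edges = \<Union>big_faces"

lemma face_cycle: "C \<in> \<F> \<Longrightarrow> is_cycle E (card C) C"
  using cycles is_cycle_card by metis

lemma face_subset: "C \<in> \<F> \<Longrightarrow> C \<subseteq> E" and face_card: "C \<in> \<F> \<Longrightarrow> 3 \<le> card C"
  using face_cycle by (simp_all add: is_cycle_def)

lemma face_finite: "C \<in> \<F> \<Longrightarrow> finite C"
  using face_subset fin finite_subset by metis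

lemma finite_faces: "finite \<F>"
  by (rule finite_subset[of _ "Pow E"]) (use face_subset fin in auto)

lemma finite_triangles: "finite triangles" and finite_big_faces: "finite big_faces"
  using finite_faces by (simp_all add: triangles_def big_faces_def)

lemma triangleD: "T \<in> triangles \<Longrightarrow> T \<in> \<F>" "T \<in> triangles \<Longrightarrow> card T = 3" "T \<in> triangles \<Longrightarrow> is_triangle E T"
  using face_cycle[of T] by (auto simp: triangles_def)

lemma bigD: "C \<in> big_faces \<Longrightarrow> C \<in> \<F>" "C \<in> big_faces \<Longrightarrow> 5 \<le> card C"
  by (auto simp: big_faces_def)

lemma not_three_faces:
  assumes "A \<in> \<F>" "B \<in> \<F>" "C \<in> \<F>" "e \<in> A" "e \<in> B" "e \<in> C" "A \<noteq> B" "B \<noteq> C"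
  shows "A = C"
proof (rule ccontr)
  assume "A \<noteq> C"
  have "e \<in> E" using face_subset assms by blast
  have "card {A, B, C} \<le> card {C \<in> \<F>. e \<in> C}"
    by (rule card_mono) (use finite_faces assms in auto)
  then show False using two_faces[OF \<open>e \<in> E\<close>] assms(7,8) \<open>A \<noteq> C\<close> by simp
qed

lemma other_face:
  assumes "C \<in> \<F>" "e \<in> C"
  obtains D where "D \<in> \<F>" "e \<in> D" "D \<noteq> C"
proof -
  have "e \<in> E" using face_subset assms by blast
  have "\<not> {D \<in> \<F>. e \<in> D} \<subseteq> {C}"
  proof
    assume "{D \<in> \<F>. e \<in> D} \<subseteq> {C}"
    then have "card {D \<in> \<F>. e \<in> D} \<le> card {C}" by (intro card_mono) auto
    then show False using two_faces[OF \<open>e \<in> E\<close>] by simp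
  qed
  then show ?thesis using that by blast
qed

lemma sum_card_faces: "(\<Sum>C\<in>\<F>. card C) = 2 * card E"
proof -
  have "(\<Sum>C\<in>\<F>. card C) = (\<Sum>C\<in>\<F>. card {e \<in> E. e \<in> C})"
  proof (rule sum.cong)
    fix C assume "C \<in> \<F>"
    then have "{e \<in> E. e \<in> C} = C" using face_subset by blast
    then show "card C = card {e \<in> E. e \<in> C}" by simp
  qed simp
  also have "\<dots> = (\<Sum>e\<in>E. card {C \<in> \<F>. e \<in> C})"
    using sum_multicount_gen[OF finite_faces fin, of "\<lambda>C e. e \<in> C" "\<lambda>e. card {C \<in> \<F>. e \<in> C}"] by simp
  also have "\<dots> = 2 * card E" using two_faces by simp
  finally show ?thesis .
qed

text \<open>Otherwise the edge would lie on three faces, two triangles and a long one.\<close>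

lemma disjoint_on_mixed_edges:
  assumes "T \<in> triangles" "T' \<in> triangles" "T \<noteq> T'" "e \<in> T" "e \<in> T'"
  shows "e \<notin> big_edges"
proof
  assume "e \<in> big_edges"
  then obtain C where C: "C \<in> big_faces" "e \<in> C" by (auto simp: big_edges_def)
  have "card T = 3" "card T' = 3" "5 \<le> card C" using assms C triangleD bigD by auto
  then have "T' \<noteq> C" "T \<noteq> C" by auto
  then show False using not_three_faces[of T T' C e] assms C triangleD(1) bigD(1) by metis
qed

text \<open>Both sides count the edges between a triangular and a long face; each such edge lies on
  exactly one face of either kind.\<close>

lemma double_count: "(\<Sum>T\<in>triangles. card (T \<inter> big_edges)) = (\<Sum>C\<in>big_faces. card (C \<inter> tri_edges))"
proof -
  have "(\<Sum>T\<in>triangles. card (T \<inter> big_edges)) = card (\<Union>T\<in>triangles. T \<inter> big_edges)"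
  proof (rule card_UN_disjoint[symmetric, OF finite_triangles])
    show "\<forall>T\<in>triangles. finite (T \<inter> big_edges)" using face_finite triangleD(1) by blast
    show "\<forall>T\<in>triangles. \<forall>T'\<in>triangles. T \<noteq> T' \<longrightarrow> T \<inter> big_edges \<inter> (T' \<inter> big_edges) = {}"
      using disjoint_on_mixed_edges by blast
  qed
  also have "(\<Union>T\<in>triangles. T \<inter> big_edges) = (\<Union>C\<in>big_faces. C \<inter> tri_edges)"
    by (auto simp: tri_edges_def big_edges_def)
  also have "card \<dots> = (\<Sum>C\<in>big_faces. card (C \<inter> tri_edges))"
  proof (rule card_UN_disjoint[OF finite_big_faces])
    show "\<forall>C\<in>big_faces. finite (C \<inter> tri_edges)" using face_finite bigD(1) by blast
    show "\<forall>C\<in>big_faces. \<forall>C'\<in>big_faces. C \<noteq> C' \<longrightarrow> C \<inter> tri_edges \<inter> (C' \<inter> tri_edges) = {}"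
    proof (intro ballI impI, rule ccontr)
      fix C C' assume C: "C \<in> big_faces" "C' \<in> big_faces" "C \<noteq> C'" "C \<inter> tri_edges \<inter> (C' \<inter> tri_edges) \<noteq> {}"
      then obtain e T where e: "e \<in> C" "e \<in> C'" "T \<in> triangles" "e \<in> T" by (auto simp: tri_edges_def)
      have "card T = 3" "5 \<le> card C'" "5 \<le> card C" using C e triangleD bigD by auto
      then have "C' \<noteq> T" "C \<noteq> T" by auto
      then show False using not_three_faces[of C C' T e] C e triangleD(1) bigD(1) by metis
    qed
  qed
  finally show ?thesis .
qed

text \<open>The assumption says that the charges \<open>card C - 4\<close> have a nonnegative sum: a
  triangle has -1 and a 4-face 0. That sum is \<open>2 * card E - 4 * card \<F>\<close>.\<close>

lemma faces_bound_if:
  assumes "card triangles \<le> (\<Sum>C\<in>big_faces. card C - 4)"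
  shows "2 * card \<F> \<le> card E"
proof -
  have part: "\<F> = triangles \<union> {C \<in> \<F>. card C = 4} \<union> big_faces"
    using face_card by (force simp: triangles_def big_faces_def)
  \<comment> \<open>Charges are integers because triangles are negative; on long faces the truncated
    subtraction is exact.\<close>
  let ?f = "\<lambda>C :: 'a set set. int (card C) - 4"
  have "sum ?f \<F> = sum ?f (triangles \<union> {C \<in> \<F>. card C = 4}) + sum ?f big_faces"
    by (subst part, rule sum.union_disjoint) (use finite_faces in \<open>auto simp: triangles_def big_faces_def\<close>)
  also have "sum ?f (triangles \<union> {C \<in> \<F>. card C = 4}) = sum ?f triangles + sum ?f {C \<in> \<F>. card C = 4}"
    by (rule sum.union_disjoint) (use finite_faces in \<open>auto simp: triangles_def\<close>)
  also have "sum ?f triangles = - int (card triangles)" using triangleD(2) by simp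
  also have "sum ?f {C \<in> \<F>. card C = 4} = 0" by simp
  also have "sum ?f big_faces = int (\<Sum>C\<in>big_faces. card C - 4)"
  proof -
    have "sum ?f big_faces = (\<Sum>C\<in>big_faces. int (card C - 4))"
    proof (intro sum.cong refl)
      fix C assume "C \<in> big_faces"
      then show "?f C = int (card C - 4)" using bigD(2)[of C] by simp
    qed
    then show ?thesis by simp
  qed
  finally have "0 \<le> sum ?f \<F>" using assms by linarith
  moreover have "sum ?f \<F> = 2 * int (card E) - 4 * int (card \<F>)"
    using arg_cong[OF sum_card_faces, of int] by (simp add: sum_subtractf)
  ultimately show ?thesis by linarith
qed

lemma nonadjacent_faces_bound:
  assumes na: "nonadjacent_triangles E"
  shows "2 * card \<F> \<le> card E"
proof (rule faces_bound_if)
  have T3: "card (T \<inter> big_edges) = 3" if T: "T \<in> triangles" for T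
  proof -
    have "T \<subseteq> big_edges"
    proof
      fix e assume e: "e \<in> T"
      obtain D where D: "D \<in> \<F>" "e \<in> D" "D \<noteq> T" by (rule other_face[OF triangleD(1)[OF T] e])
      then have "adjacent_cycles T D" using e by (auto simp: adjacent_cycles_def)
      then have "\<not> is_cycle E 3 D" "\<not> is_cycle E 4 D"
        using na triangleD(3)[OF T] unfolding nonadjacent_triangles_def by blast+
      then have "card D \<noteq> 3" "card D \<noteq> 4" using face_cycle[OF D(1)] by metis+
      then have "D \<in> big_faces" using face_card[OF D(1)] D(1) by (simp add: big_faces_def)
      then show "e \<in> big_edges" using D(2) by (auto simp: big_edges_def)
    qed
    then have "T \<inter> big_edges = T" by blast
    then show ?thesis using triangleD(2)[OF T] by simp
  qed
  have s: "card (C \<inter> tri_edges) \<le> 3 * (card C - 4)" if C: "C \<in> big_faces" for C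
  \<comment> \<open>From length 6 on, every edge of the face can be paid for; at length 5 only three
    can.\<close>
  proof (cases "card C = 5")
    case True
    then have C5: "is_cycle E 5 C" using face_cycle[OF bigD(1)[OF C]] by simp
    have "\<forall>e\<in>C \<inter> tri_edges. \<exists>T. T \<in> triangles \<and> e \<in> T" by (auto simp: tri_edges_def)
    \<comment> \<open>Distinct edges of the 5-face belong to distinct triangles, so the bound on
      adjacent triangles bounds the edges.\<close>
    then obtain t where t: "\<And>e. e \<in> C \<inter> tri_edges \<Longrightarrow> t e \<in> triangles \<and> e \<in> t e" by metis
    have "inj_on t (C \<inter> tri_edges)"
    proof (rule inj_onI)
      fix e f assume ef: "e \<in> C \<inter> tri_edges" "f \<in> C \<inter> tri_edges" "t e = t f"
      then have "is_triangle E (t e)" "e \<in> t e" "f \<in> t e" using t triangleD(3) by auto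
      then show "e = f" using triangle_five_cycle[OF na _ C5] ef(1,2) by blast
    qed
    moreover have "t ` (C \<inter> tri_edges) \<subseteq> {T. is_triangle E T \<and> adjacent_cycles C T}"
    proof
      fix T assume "T \<in> t ` (C \<inter> tri_edges)"
      then obtain e where e: "e \<in> C" "T = t e" "T \<in> triangles" "e \<in> T" using t by blast
      have "C \<noteq> T" using triangleD(2)[OF e(3)] True by auto
      then show "T \<in> {T. is_triangle E T \<and> adjacent_cycles C T}"
        using e triangleD(3)[OF e(3)] by (auto simp: adjacent_cycles_def)
    qed
    ultimately have "card (C \<inter> tri_edges) \<le> card {T. is_triangle E T \<and> adjacent_cycles C T}"
      by (rule card_inj_on_le) (rule finite_cycles[OF fin])
    also have "\<dots> \<le> 3" using na C5 unfolding nonadjacent_triangles_def by blast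
    finally show ?thesis using True by simp
  next
    case False
    have "card (C \<inter> tri_edges) \<le> card C" using face_finite[OF bigD(1)[OF C]] by (intro card_mono) auto
    also have "\<dots> \<le> 3 * (card C - 4)" using False bigD(2)[OF C] by linarith
    finally show ?thesis .
  qed
  have "3 * card triangles = (\<Sum>T\<in>triangles. card (T \<inter> big_edges))" using T3 by simp
  also have "\<dots> = (\<Sum>C\<in>big_faces. card (C \<inter> tri_edges))" by (rule double_count)
  also have "\<dots> \<le> (\<Sum>C\<in>big_faces. 3 * (card C - 4))" using s by (intro sum_mono)
  also have "\<dots> = 3 * (\<Sum>C\<in>big_faces. card C - 4)" by (simp add: sum_distrib_left)
  finally show "card triangles \<le> (\<Sum>C\<in>big_faces. card C - 4)" by simp
qed

text \<open>An edge of \<open>T\<close> on no long face borders a 4-face, since a second triangle is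
  excluded. At most one 4-cycle is adjacent to \<open>T\<close>, and it shares only one edge with
  \<open>T\<close>.\<close>

lemma separated_big_edges:
  assumes sep: "separated_triangles E" and T: "T \<in> triangles"
  shows "2 \<le> card (T \<inter> big_edges)"
proof -
  let ?N = "T - big_edges"
  have finT: "finite T" using face_finite triangleD(1)[OF T] by blast
  have Q: "\<exists>Q. is_cycle E 4 Q \<and> adjacent_cycles T Q \<and> e \<in> Q" if e: "e \<in> ?N" for e
  proof -
    obtain D where D: "D \<in> \<F>" "e \<in> D" "D \<noteq> T" by (rule other_face[OF triangleD(1)[OF T]]) (use e in blast)
    have "D \<notin> big_faces" using e D(2) by (auto simp: big_edges_def)
    then have "card D \<le> 4" using D(1) by (simp add: big_faces_def)
    moreover have "card D \<noteq> 3"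
    proof
      assume "card D = 3"
      then have "is_triangle E D" using face_cycle[OF D(1)] by simp
      moreover have "e \<noteq> {}"
        using triangle_edges_meet[OF triangleD(3)[OF T], of e] e triangleD(2)[OF T]
          triangleD(3)[OF T] unfolding is_cycle_3_iff by auto
      ultimately show False
        using separated_triangles_eq[OF sep triangleD(3)[OF T], of D e e] D e by blast
    qed
    ultimately have "is_cycle E 4 D" using face_card[OF D(1)] face_cycle[OF D(1)] by (cases "card D = 4") auto
    moreover have "adjacent_cycles T D" using D e by (auto simp: adjacent_cycles_def)
    ultimately show ?thesis using D(2) by blast
  qed
  have one: "card {Q. is_cycle E 4 Q \<and> adjacent_cycles T Q} \<le> Suc 0"
    using sep triangleD(3)[OF T] by (simp add: separated_triangles_def)
  have "e = f" if ef: "e \<in> ?N" "f \<in> ?N" for e f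
  proof -
    obtain Q1 where Q1: "is_cycle E 4 Q1" "adjacent_cycles T Q1" "e \<in> Q1" using Q[OF ef(1)] by blast
    obtain Q2 where Q2: "is_cycle E 4 Q2" "adjacent_cycles T Q2" "f \<in> Q2" using Q[OF ef(2)] by blast
    have "Q1 = Q2"
      using one Q1 Q2 unfolding card_le_Suc0_iff_eq[OF finite_cycles[OF fin]] by simp
    then show ?thesis using triangle_four_cycle[OF sep triangleD(3)[OF T] Q1(1)] Q1(3) Q2(3) ef by blast
  qed
  then have "card ?N \<le> Suc 0" unfolding card_le_Suc0_iff_eq[OF finite_Diff[OF finT]] by blast
  moreover have "card T = card (T \<inter> big_edges) + card ?N"
    using card_Un_disjoint[of "T \<inter> big_edges" ?N] finT by (simp add: Int_Diff_disjoint Int_Diff_Un)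
  ultimately show ?thesis using triangleD(2)[OF T] by linarith
qed

text \<open>Consecutive edges share a vertex, so by (i) all three belong to one triangle, where a
  walk along three distinct edges returns to its start.\<close>

lemma no_three_consecutive_tri_edges:
  assumes sep: "separated_triangles E" and d: "distinct [a, b, c, d]"
    and e: "{a, b} \<in> tri_edges" "{b, c} \<in> tri_edges" "{c, d} \<in> tri_edges"
  shows False
proof -
  obtain T1 T2 T3 where T: "T1 \<in> triangles" "{a, b} \<in> T1" "T2 \<in> triangles" "{b, c} \<in> T2"
    "T3 \<in> triangles" "{c, d} \<in> T3" using e by (auto simp: tri_edges_def)
  have "T1 = T2"
    by (rule separated_triangles_eq[OF sep triangleD(3)[OF T(1)] triangleD(3)[OF T(3)] T(2) T(4), of b]) simp_all
  moreover have "T2 = T3"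
    by (rule separated_triangles_eq[OF sep triangleD(3)[OF T(3)] triangleD(3)[OF T(5)] T(4) T(6), of c]) simp_all
  ultimately have m: "{a, b} \<in> T1" "{b, c} \<in> T1" "{c, d} \<in> T1" "a \<noteq> c" using T d by auto
  have "T1 = {{a, b}, {b, c}, {c, a}}"
    by (rule triangle_two_edges[OF triangleD(3)[OF T(1)] m(1,2,4)])
  then show False using m(3) d by (auto simp: doubleton_eq_iff)
qed

text \<open>Of any three consecutive edges one is on no triangular face; the cycle is listed so that
  such an edge closes it.\<close>

lemma big_face_walk:
  assumes sep: "separated_triangles E" and C: "C \<in> big_faces"
  obtains v0 v1 v2 v3 vs where "distinct (v0 # v1 # v2 # v3 # vs)" "vs \<noteq> []" "length vs + 4 = card C"
    "C = path_edges (v0 # v1 # v2 # v3 # vs @ [v0])" "{last vs, v0} \<notin> tri_edges"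
proof -
  have Cc: "is_cycle E (card C) C" using face_cycle bigD(1)[OF C] by blast
  have long: "\<exists>v1 v2 v3 vs. xs = v1 # v2 # v3 # vs \<and> vs \<noteq> []" if "Suc (length xs) = card C" for xs :: "'a list"
  proof -
    have "4 \<le> length xs" using that bigD(2)[OF C] by linarith
    then obtain v1 v2 v3 v4 vs where "xs = v1 # v2 # v3 # v4 # vs"
      by (auto simp: Suc_le_length_iff eval_nat_numeral)
    then show ?thesis by blast
  qed
  obtain x xs where x: "distinct (x # xs)" "Suc (length xs) = card C" "C = path_edges (x # xs @ [x])"
    using Cc[unfolded is_cycle_iff] by (elim conjE exE)
  obtain w1 w2 w3 ws where w: "xs = w1 # w2 # w3 # ws" using long[OF x(2)] by blast
  have "{x, w1} \<notin> tri_edges \<or> {w1, w2} \<notin> tri_edges \<or> {w2, w3} \<notin> tri_edges"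
    using no_three_consecutive_tri_edges[OF sep, of x w1 w2 w3] x(1) w by auto
  moreover have "{x, w1} \<in> C" "{w1, w2} \<in> C" "{w2, w3} \<in> C" using x(3) w by auto
  ultimately obtain p q where "{p, q} \<in> C" and pq: "{p, q} \<notin> tri_edges" by metis
  from is_cycle_edge[OF Cc this(1)] obtain ys where ys: "distinct (q # ys)" "Suc (length ys) = card C"
    "C = path_edges (q # ys @ [q])" "last ys = p" .
  obtain v1 v2 v3 vs where v: "ys = v1 # v2 # v3 # vs" "vs \<noteq> []" using long[OF ys(2)] by blast
  show ?thesis
    by (rule that[of q v1 v2 v3 vs]) (use ys v pq in auto)
qed

text \<open>The closing edge and one of the first three edges are on no triangular face. Since
  \<open>l - 2 \<le> 2 * (l - 4)\<close> for \<open>l \<ge> 6\<close>, only 5-faces can exceed their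
  budget of half payments.\<close>

lemma separated_tri_edges:
  assumes sep: "separated_triangles E" and C: "C \<in> big_faces"
  shows "card (C \<inter> tri_edges) \<le> card C - 2"
proof -
  obtain v0 v1 v2 v3 vs where v: "distinct (v0 # v1 # v2 # v3 # vs)" "vs \<noteq> []"
    "C = path_edges (v0 # (v1 # v2 # v3 # vs) @ [v0])" "{last vs, v0} \<notin> tri_edges"
    using big_face_walk[OF sep C] by (metis append_Cons)
  let ?P = "path_edges (v0 # v1 # v2 # v3 # vs)"
  have Ceq: "C = insert {last vs, v0} ?P"
    using closed_path_edges[of "v1 # v2 # v3 # vs" v0] v(2,3) by simp
  have "{v0, v1} \<notin> tri_edges \<or> {v1, v2} \<notin> tri_edges \<or> {v2, v3} \<notin> tri_edges"
    using no_three_consecutive_tri_edges[OF sep, of v0 v1 v2 v3] v(1) by auto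
  moreover have "{v0, v1} \<in> ?P" "{v1, v2} \<in> ?P" "{v2, v3} \<in> ?P" by simp_all
  ultimately obtain e where e: "e \<in> ?P" "e \<notin> tri_edges" by metis
  have "last (v1 # v2 # v3 # vs) = last vs" using v(2) by simp
  then have "{last vs, v0} \<notin> ?P" using closing_edge_notin[OF v(1)] by simp
  then have "e \<noteq> {last vs, v0}" using e(1) by blast
  moreover have "{e, {last vs, v0}} \<subseteq> C" using Ceq e(1) by simp
  ultimately have "card (C - {e, {last vs, v0}}) = card C - 2"
    using face_finite[OF bigD(1)[OF C]] by (simp add: card_Diff_subset)
  moreover have "card (C \<inter> tri_edges) \<le> card (C - {e, {last vs, v0}})"
    by (rule card_mono) (use face_finite[OF bigD(1)[OF C]] e(2) v(4) in auto)
  ultimately show ?thesis by simp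
qed

text \<open>A 4-face across the third edge of a triangle having two edges on a 5-face would have to be the
  4-cycle closing up the rest of the 5-face; but the edge \<open>{d, d'}\<close> is already on two other faces.\<close>

lemma exceptional_triangle:
  assumes sep: "separated_triangles E" and C: "C \<in> big_faces" "card C = 5"
    and d: "distinct [a, b, c, d, d']" and Ceq: "C = {{a, b}, {b, c}, {c, d}, {d, d'}, {d', a}}"
    and tri: "{a, b} \<in> tri_edges" "{b, c} \<in> tri_edges" "{d, d'} \<in> tri_edges"
  shows "\<exists>T\<in>triangles. 2 \<le> card (T \<inter> C) \<and> card (T \<inter> big_edges) = 3"
proof -
  obtain T1 T2 T' where T: "T1 \<in> triangles" "{a, b} \<in> T1" "T2 \<in> triangles" "{b, c} \<in> T2"
    "T' \<in> triangles" "{d, d'} \<in> T'" using tri by (auto simp: tri_edges_def)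
  have "T1 = T2"
    by (rule separated_triangles_eq[OF sep triangleD(3)[OF T(1)] triangleD(3)[OF T(3)] T(2) T(4), of b]) simp_all
  then have m: "{a, b} \<in> T1" "{b, c} \<in> T1" "a \<noteq> c" using T d by auto
  have Teq: "T1 = {{a, b}, {b, c}, {c, a}}"
    by (rule triangle_two_edges[OF triangleD(3)[OF T(1)] m])
  have CF: "C \<in> \<F>" using bigD(1)[OF C(1)] .
  have ca: "{c, a} \<in> T1" using Teq by simp
  obtain D where D: "D \<in> \<F>" "{c, a} \<in> D" "D \<noteq> T1" by (rule other_face[OF triangleD(1)[OF T(1)] ca])
  have "card D \<noteq> 3"
  proof
    assume "card D = 3"
    then have "is_triangle E D" using face_cycle[OF D(1)] by simp
    then have "T1 = D"
      by (rule separated_triangles_eq[OF sep triangleD(3)[OF T(1)] _ ca D(2), of c]) simp_all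
    then show False using D(3) by simp
  qed
  moreover have "card D \<noteq> 4"
  proof
    assume D4: "card D = 4"
    let ?Q = "{{a, c}, {c, d}, {d, d'}, {d', a}}"
    have "{{c, d}, {d, d'}, {d', a}} \<subseteq> E" using Ceq face_subset[OF CF] by simp
    note Q = shortcut_four_cycle[OF d triangleD(3)[OF T(1)] ca this]
    have "is_cycle E 4 D" using face_cycle[OF D(1)] D4 by simp
    moreover have "adjacent_cycles T1 D" using D ca by (auto simp: adjacent_cycles_def)
    moreover have "card {Q. is_cycle E 4 Q \<and> adjacent_cycles T1 Q} \<le> Suc 0"
      using sep triangleD(3)[OF T(1)] by (simp add: separated_triangles_def)
    ultimately have "D = ?Q"
      using Q unfolding card_le_Suc0_iff_eq[OF finite_cycles[OF fin]] by simp
    then have "{d, d'} \<in> D" by simp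
    moreover have "{d, d'} \<in> C" using Ceq by simp
    moreover have "D \<noteq> C" "C \<noteq> T'" "D \<noteq> T'" using D4 C(2) triangleD(2)[OF T(5)] by auto
    ultimately show False
      using not_three_faces[OF D(1) CF triangleD(1)[OF T(5)] _ _ T(6)] by blast
  qed
  ultimately have "D \<in> big_faces" using face_card[OF D(1)] D(1) by (simp add: big_faces_def)
  then have "{c, a} \<in> big_edges" using D(2) by (auto simp: big_edges_def)
  moreover have "{a, b} \<in> C" "{b, c} \<in> C" using Ceq by simp_all
  moreover have "C \<subseteq> big_edges" using C(1) by (auto simp: big_edges_def)
  ultimately have "T1 \<subseteq> big_edges" "{{a, b}, {b, c}} \<subseteq> T1 \<inter> C" using Teq by auto
  moreover have "{a, b} \<noteq> {b, c}" using m(3) by (auto simp: doubleton_eq_iff)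
  ultimately have "T1 \<inter> big_edges = T1" "2 \<le> card (T1 \<inter> C)"
    using card_mono[of "T1 \<inter> C" "{{a, b}, {b, c}}"] face_finite[OF CF] by auto
  then show ?thesis using T(1) triangleD(2)[OF T(1)] by (intro bexI[of _ T1]) simp_all
qed

text \<open>The triangle edges lie on the path from \<open>v0\<close> to \<open>v4\<close>: at least
  three of its four edges, but no three consecutive ones. So exactly one of the two middle edges is
  missing.\<close>

lemma exceptional_face:
  assumes sep: "separated_triangles E" and C: "C \<in> big_faces" "card C = 5" "3 \<le> card (C \<inter> tri_edges)"
  shows "\<exists>T\<in>triangles. 2 \<le> card (T \<inter> C) \<and> card (T \<inter> big_edges) = 3"
proof -
  obtain v0 v1 v2 v3 vs where v: "distinct (v0 # v1 # v2 # v3 # vs)" "length vs + 4 = card C"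
    "C = path_edges (v0 # v1 # v2 # v3 # vs @ [v0])" "{last vs, v0} \<notin> tri_edges"
    using big_face_walk[OF sep C(1)] by metis
  obtain v4 where v4: "vs = [v4]" using v(2) C(2) by (cases vs) auto
  have d: "distinct [v0, v1, v2, v3, v4]" using v(1) v4 by simp
  have Ceq: "C = {{v0, v1}, {v1, v2}, {v2, v3}, {v3, v4}, {v4, v0}}" using v(3) v4 by auto
  let ?t = "\<lambda>e. e \<in> tri_edges"
  let ?S = "C \<inter> tri_edges"
  have few: "\<not> ?S \<subseteq> {e, f}" for e f
  proof
    assume "?S \<subseteq> {e, f}"
    then have "card ?S \<le> card {e, f}" by (intro card_mono) auto
    also have "\<dots> \<le> 2" by (simp add: card_insert_if)
    finally show False using C(3) by simp
  qed
  have n: "\<not> ?t {v4, v0}" using v(4) v4 by simp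
  have l: "\<not> (?t {v0, v1} \<and> ?t {v1, v2} \<and> ?t {v2, v3})" "\<not> (?t {v1, v2} \<and> ?t {v2, v3} \<and> ?t {v3, v4})"
    using no_three_consecutive_tri_edges[OF sep, of v0 v1 v2 v3] no_three_consecutive_tri_edges[OF sep, of v1 v2 v3 v4] d
    by auto
  \<comment> \<open>If two of the four edges failed, at most two triangle edges would
    remain.\<close>
  have m: "?t e \<or> ?t f" if "\<forall>x\<in>C. x = e \<or> x = f \<or> x = g \<or> x = h \<or> x = {v4, v0}" for e f g h
  proof (rule ccontr)
    assume "\<not> (?t e \<or> ?t f)"
    then have "?S \<subseteq> {g, h}" using that n by auto
    then show False using few by simp
  qed
  have "?t {v1, v2} \<or> ?t {v2, v3}" by (rule m[of _ _ "{v0, v1}" "{v3, v4}"]) (simp add: Ceq)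
  moreover have "?t {v0, v1} \<or> ?t {v1, v2}" by (rule m[of _ _ "{v2, v3}" "{v3, v4}"]) (simp add: Ceq)
  moreover have "?t {v0, v1} \<or> ?t {v2, v3}" by (rule m[of _ _ "{v1, v2}" "{v3, v4}"]) (simp add: Ceq)
  moreover have "?t {v0, v1} \<or> ?t {v3, v4}" by (rule m[of _ _ "{v1, v2}" "{v2, v3}"]) (simp add: Ceq)
  moreover have "?t {v1, v2} \<or> ?t {v3, v4}" by (rule m[of _ _ "{v0, v1}" "{v2, v3}"]) (simp add: Ceq)
  moreover have "?t {v2, v3} \<or> ?t {v3, v4}" by (rule m[of _ _ "{v0, v1}" "{v1, v2}"]) (simp add: Ceq)
  ultimately consider "?t {v0, v1}" "?t {v1, v2}" "?t {v3, v4}" | "?t {v0, v1}" "?t {v2, v3}" "?t {v3, v4}"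
    using l by blast
  then show ?thesis
  proof cases
    case 1
    then show ?thesis by (rule exceptional_triangle[OF sep C(1,2) d Ceq])
  next
    case 2
    \<comment> \<open>The second pattern is the first one read backwards.\<close>
    have d': "distinct [v4, v3, v2, v1, v0]" using d by auto
    have Ceq': "C = {{v4, v3}, {v3, v2}, {v2, v1}, {v1, v0}, {v0, v4}}"
      unfolding Ceq by (simp add: insert_commute)
    show ?thesis
      by (rule exceptional_triangle[OF sep C(1,2) d' Ceq']) (use 2 in \<open>simp_all add: insert_commute\<close>)
  qed
qed

text \<open>In half units, \<open>X\<close> holds the 5-faces one payment over budget and
  \<open>Y\<close> the triangles receiving one payment too many; an injection from \<open>X\<close>
  to \<open>Y\<close> balances the account.\<close>

lemma separated_faces_bound:
  assumes sep: "separated_triangles E"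
  shows "2 * card \<F> \<le> card E"
proof (rule faces_bound_if)
  define X where "X = {C \<in> big_faces. card C = 5 \<and> 3 \<le> card (C \<inter> tri_edges)}"
  define Y where "Y = {T \<in> triangles. card (T \<inter> big_edges) = 3}"
  have finXY: "finite X" "finite Y" using finite_big_faces finite_triangles by (simp_all add: X_def Y_def)
  have "\<forall>C\<in>X. \<exists>T. T \<in> Y \<and> 2 \<le> card (T \<inter> C)"
    using exceptional_face[OF sep] unfolding X_def Y_def by blast
  then obtain t where t: "\<And>C. C \<in> X \<Longrightarrow> t C \<in> Y \<and> 2 \<le> card (t C \<inter> C)" by metis
  \<comment> \<open>Two faces with the same triangle would each use two of its three edges, hence
    share one, which would then lie on three faces.\<close>
  have "inj_on t X"
  proof (rule inj_onI, rule ccontr)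
    fix C D assume CD: "C \<in> X" "D \<in> X" "t C = t D" "C \<noteq> D"
    let ?T = "t C"
    have T: "?T \<in> triangles" "2 \<le> card (?T \<inter> C)" "2 \<le> card (?T \<inter> D)"
      using t[OF CD(1)] t[OF CD(2)] CD(3) by (auto simp: Y_def)
    have finT: "finite ?T" using face_finite triangleD(1)[OF T(1)] by blast
    have "card (?T \<inter> C) + card (?T \<inter> D) = card (?T \<inter> C \<union> ?T \<inter> D) + card (?T \<inter> C \<inter> (?T \<inter> D))"
      using finT by (intro card_Un_Int) auto
    moreover have "card (?T \<inter> C \<union> ?T \<inter> D) \<le> card ?T" using finT by (intro card_mono) auto
    ultimately have "card (?T \<inter> C \<inter> (?T \<inter> D)) \<noteq> 0" using T triangleD(2)[OF T(1)] by linarith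
    then obtain e where e: "e \<in> ?T" "e \<in> C" "e \<in> D" by (metis IntE card.empty ex_in_conv)
    have C5: "card C = 5" "card D = 5" "C \<in> \<F>" "D \<in> \<F>" using CD(1,2) bigD(1) by (auto simp: X_def)
    then have "D \<noteq> ?T" "C \<noteq> ?T" using triangleD(2)[OF T(1)] by auto
    then show False using not_three_faces[OF C5(3,4) triangleD(1)[OF T(1)] e(2,3,1) CD(4)] by blast
  qed
  then have XY: "card X \<le> card Y" using t finXY by (intro card_inj_on_le[of t]) auto
  \<comment> \<open>Lower estimate of the payments received: two per triangle, three on
    \<open>Y\<close>.\<close>
  have "2 * card triangles + card Y = (\<Sum>T\<in>triangles. 2) + (\<Sum>T\<in>triangles. if card (T \<inter> big_edges) = 3 then 1 else 0)"
    using finite_triangles by (simp add: Y_def sum.inter_filter[symmetric])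
  also have "\<dots> = (\<Sum>T\<in>triangles. 2 + (if card (T \<inter> big_edges) = 3 then 1 else 0))"
    by (rule sum.distrib[symmetric])
  also have "\<dots> \<le> (\<Sum>T\<in>triangles. card (T \<inter> big_edges))"
  proof (rule sum_mono)
    fix T assume T: "T \<in> triangles"
    show "2 + (if card (T \<inter> big_edges) = 3 then 1 else 0) \<le> card (T \<inter> big_edges)"
      using separated_big_edges[OF sep T] by simp
  qed
  also have "\<dots> = (\<Sum>C\<in>big_faces. card (C \<inter> tri_edges))" by (rule double_count)
  \<comment> \<open>Upper estimate of the payments made: the budget, exceeded by at most one on
    \<open>X\<close>.\<close>
  also have "\<dots> \<le> (\<Sum>C\<in>big_faces. 2 * (card C - 4) + (if card C = 5 \<and> 3 \<le> card (C \<inter> tri_edges) then 1 else 0))"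
  proof (rule sum_mono)
    fix C assume C: "C \<in> big_faces"
    show "card (C \<inter> tri_edges) \<le> 2 * (card C - 4) + (if card C = 5 \<and> 3 \<le> card (C \<inter> tri_edges) then 1 else 0)"
      using separated_tri_edges[OF sep C] bigD(2)[OF C] by (cases "card C = 5") auto
  qed
  also have "\<dots> = 2 * (\<Sum>C\<in>big_faces. card C - 4) + card X"
    using finite_big_faces by (simp add: X_def sum.distrib sum_distrib_left sum.inter_filter[symmetric])
  finally show "card triangles \<le> (\<Sum>C\<in>big_faces. card C - 4)" using XY by linarith
qed

end

section \<open>Sparsity of plane graphs without nearby triangles\<close>

lemma rtrancl_path:
  assumes "(x, y) \<in> {(a, b). {a, b} \<in> E \<and> a \<notin> U \<and> b \<notin> U}\<^sup>*" "x \<notin> U"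
  shows "\<exists>xs. distinct xs \<and> xs \<noteq> [] \<and> hd xs = x \<and> last xs = y \<and> path_edges xs \<subseteq> E \<and> set xs \<inter> U = {}"
  using assms(1)
proof (induction rule: rtrancl_induct)
  case base
  then show ?case using assms(2) by (intro exI[of _ "[x]"]) simp
next
  case (step y z)
  then obtain xs where xs: "distinct xs" "xs \<noteq> []" "hd xs = x" "last xs = y" "path_edges xs \<subseteq> E" "set xs \<inter> U = {}"
    by (elim exE conjE)
  have yz: "{y, z} \<in> E" "z \<notin> U" using step(2) by auto
  show ?case
  proof (cases "z \<in> set xs")
    case True
    \<comment> \<open>When the walk returns to a vertex, the path is cut back to it and so stays
      simple.\<close>
    then obtain as bs where ab: "xs = as @ z # bs" by (meson split_list)
    have "path_edges (as @ [z]) \<subseteq> E" using xs(5) path_edges_append[of as z bs] ab by simp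
    moreover have "hd (as @ [z]) = x" using xs(3) ab by (cases as) auto
    ultimately show ?thesis using xs(1,6) ab by (intro exI[of _ "as @ [z]"]) auto
  next
    case False
    obtain ys where ys: "xs = ys @ [y]" using xs(2,4) by (metis append_butlast_last_id)
    have "path_edges (ys @ [y, z]) \<subseteq> E" using xs(5) ys yz(1) by (simp add: path_edges_snoc2)
    moreover have "hd (ys @ [y, z]) = x" using xs(3) ys by (cases ys) auto
    ultimately show ?thesis using xs(1,6) ys yz(2) False by (intro exI[of _ "ys @ [y, z]"]) auto
  qed
qed

text \<open>Without an ear, a component \<open>W\<close> of the graph off \<open>\<Union>H\<close>
  attaches to \<open>\<Union>H\<close> in at most one vertex. Then \<open>W\<close> with this vertex
  and \<open>V - W\<close> are proper parts covering all edges, so \<open>card E\<close> is at most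
  \<open>(2 * (card W + 1) - 3) + (2 * (card V - card W) - 3) = 2 * card V - 4\<close>, against
  \<open>dense\<close>.\<close>

lemma ear_exists:
  assumes G: "simple_graph V E" and H: "H \<subseteq> E" "H \<noteq> E" "2 \<le> card (\<Union>H)"
    and sparse: "\<And>A. A \<subset> V \<Longrightarrow> 2 \<le> card A \<Longrightarrow> card {e \<in> E. e \<subseteq> A} + 3 \<le> 2 * card A"
    and dense: "2 * card V < card E + 3"
  shows "\<exists>u ps w. distinct (u # ps @ [w]) \<and> path_edges (u # ps @ [w]) \<subseteq> E \<and>
    path_edges (u # ps @ [w]) \<inter> H = {} \<and> u \<in> \<Union>H \<and> w \<in> \<Union>H \<and> set ps \<inter> \<Union>H = {}"
proof (rule ccontr)
  assume no_ear: "\<not> ?thesis"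
  define U where "U = \<Union>H"
  have finV: "finite V" and sub: "\<And>e. e \<in> E \<Longrightarrow> e \<subseteq> V" and card2: "\<And>e. e \<in> E \<Longrightarrow> card e = 2"
    using G by (auto simp: simple_graph_def)
  have finE: "finite E" by (rule finite_subset[of _ "Pow V"]) (use sub finV in auto)
  have UV: "U \<subseteq> V" unfolding U_def using H(1) sub by blast
  \<comment> \<open>An edge outside \<open>H\<close> between two vertices of \<open>H\<close> is
    itself an ear with \<open>ps = []\<close>; so every edge missing from \<open>H\<close> has an
    end outside \<open>U\<close>.\<close>
  have inner: "e \<in> H" if e: "e \<in> E" "e \<subseteq> U" for e
  proof (rule ccontr)
    assume "e \<notin> H"
    obtain u w where uw: "e = {u, w}" "u \<noteq> w" using card2[OF e(1)] by (auto simp: card_2_iff)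
    have "distinct (u # [] @ [w]) \<and> path_edges (u # [] @ [w]) \<subseteq> E \<and> path_edges (u # [] @ [w]) \<inter> H = {}
      \<and> u \<in> \<Union>H \<and> w \<in> \<Union>H \<and> set [] \<inter> \<Union>H = {}"
      using e uw \<open>e \<notin> H\<close> by (simp add: U_def)
    then show False using no_ear by blast
  qed
  obtain e0 where e0: "e0 \<in> E" "e0 \<notin> H" using H(1,2) by blast
  then obtain w0 where w0: "w0 \<in> e0" "w0 \<notin> U" using inner by blast
  define r where "r = {(a, b). {a, b} \<in> E \<and> a \<notin> U \<and> b \<notin> U}"
  have sym_r: "sym r" unfolding r_def sym_def by (simp add: insert_commute)
  define W where "W = r\<^sup>* `` {w0}"
  have w0W: "w0 \<in> W" by (simp add: W_def)
  have WV: "x \<in> V \<and> x \<notin> U" if "x \<in> W" for x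
  proof -
    have "(w0, x) \<in> r\<^sup>*" using that by (simp add: W_def)
    then show ?thesis
    proof (induction rule: rtrancl_induct)
      case base
      then show ?case using w0 e0 sub by blast
    next
      case (step y z)
      then have "{y, z} \<in> E" "z \<notin> U" by (auto simp: r_def)
      then show ?case using sub by blast
    qed
  qed
  \<comment> \<open>Two attachment vertices would be joined by an ear through
    \<open>W\<close>.\<close>
  have attach: "a = b" if ab: "a \<in> U" "b \<in> U" "{a, x} \<in> E" "{b, y} \<in> E" "x \<in> W" "y \<in> W" for a b x y
  proof (rule ccontr)
    assume "a \<noteq> b"
    have "(w0, x) \<in> r\<^sup>*" "(w0, y) \<in> r\<^sup>*" using ab(5,6) by (simp_all add: W_def)
    then have "(x, y) \<in> r\<^sup>*" using sym_rtrancl[OF sym_r] by (metis symD rtrancl_trans)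
    then obtain xs where xs: "distinct xs" "xs \<noteq> []" "hd xs = x" "last xs = y" "path_edges xs \<subseteq> E" "set xs \<inter> U = {}"
      using rtrancl_path[of x y E U] WV[OF ab(5)] unfolding r_def by blast
    obtain xs' where xs': "xs = x # xs'" using xs(2,3) by (cases xs) auto
    obtain ys where ys: "xs = ys @ [y]" using xs(2,4) by (metis append_butlast_last_id)
    have "path_edges (a # xs @ [b]) = insert {a, x} (path_edges (ys @ [y, b]))"
      using xs' ys by (metis append_Cons append_assoc append_Nil path_edges.simps(1))
    also have "path_edges (ys @ [y, b]) = insert {y, b} (path_edges xs)"
      using path_edges_snoc2 ys by metis
    finally have pe: "path_edges (a # xs @ [b]) = insert {a, x} (insert {y, b} (path_edges xs))" .
    have "path_edges (a # xs @ [b]) \<subseteq> E" unfolding pe using ab(3,4) xs(5) by (simp add: insert_commute)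
    moreover have "path_edges (a # xs @ [b]) \<inter> H = {}"
    proof (rule ccontr)
      assume "path_edges (a # xs @ [b]) \<inter> H \<noteq> {}"
      then obtain e where e: "e \<in> path_edges (a # xs @ [b])" "e \<in> H" by blast
      \<comment> \<open>Each edge of the path has an end outside \<open>U\<close>, so it cannot be
        in \<open>H\<close>.\<close>
      have "\<exists>v\<in>e. v \<in> set xs"
      proof (cases "e \<in> path_edges xs")
        case True
        then have "e \<noteq> {}" using path_edges_card2[OF xs(1)] by force
        then show ?thesis using path_edges_memD[OF True] by blast
      next
        case False
        then have "e = {a, x} \<or> e = {y, b}" using e(1) pe by blast
        moreover have "x \<in> set xs" "y \<in> set xs" using xs(2-4) hd_in_set last_in_set by blast+
        ultimately show ?thesis by blast
      qed
      then show False using xs(6) e(2) unfolding U_def by blast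
    qed
    moreover have "a \<notin> set xs" "b \<notin> set xs" using ab(1,2) xs(6) by auto
    then have "distinct (a # xs @ [b])" using xs(1) \<open>a \<noteq> b\<close> by simp
    ultimately show False using no_ear ab(1,2) xs(6) unfolding U_def by blast
  qed
  have "U \<noteq> {}" using H(3) unfolding U_def[symmetric] by auto
  \<comment> \<open>If nothing is attached, any vertex of \<open>U\<close> serves; this covers
    disconnected graphs.\<close>
  have "\<exists>a\<in>U. \<forall>b x. b \<in> U \<longrightarrow> x \<in> W \<longrightarrow> {b, x} \<in> E \<longrightarrow> b = a"
  proof (cases "\<exists>a x. a \<in> U \<and> x \<in> W \<and> {a, x} \<in> E")
    case True
    then obtain a x where a: "a \<in> U" "x \<in> W" "{a, x} \<in> E" by blast
    show ?thesis by (rule bexI[OF _ a(1)]) (use attach[OF _ a(1) _ a(3) _ a(2)] in simp)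
  next
    case False
    then show ?thesis using \<open>U \<noteq> {}\<close> by blast
  qed
  then obtain a where a: "a \<in> U" "\<And>b x. b \<in> U \<Longrightarrow> x \<in> W \<Longrightarrow> {b, x} \<in> E \<Longrightarrow> b = a" by blast
  let ?A = "insert a W" and ?B = "V - W"
  have finW: "finite W" by (rule finite_subset[OF _ finV]) (use WV in blast)
  have aW: "a \<notin> W" using a(1) WV by blast
  have UB: "U \<subseteq> ?B" using UV WV by blast
  have "\<not> U \<subseteq> {a}" using H(3) card_mono[of "{a}" U] unfolding U_def by auto
  then have A: "?A \<subset> V" using WV UV a(1) by blast
  have B: "?B \<subset> V" using w0W WV by blast
  have "card W > 0" using finW w0W card_gt_0_iff by blast
  then have cA: "card ?A = card W + 1" "2 \<le> card ?A" using finW aW by simp_all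
  have cB: "card ?B + card W = card V"
    using finV finW WV card_Diff_subset[OF finW, of V] card_mono[OF finV, of W] by (metis add.commute le_add_diff_inverse subsetI)
  have cB2: "2 \<le> card ?B" using card_mono[of ?B U] UB finV H(3) unfolding U_def by (meson finite_Diff le_trans)
  \<comment> \<open>No edge leaves \<open>W\<close> except to \<open>a\<close>.\<close>
  have "E \<subseteq> {e \<in> E. e \<subseteq> ?A} \<union> {e \<in> E. e \<subseteq> ?B}"
  proof
    fix e assume e: "e \<in> E"
    show "e \<in> {e \<in> E. e \<subseteq> ?A} \<union> {e \<in> E. e \<subseteq> ?B}"
    proof (cases "e \<inter> W = {}")
      case True
      then show ?thesis using e sub by blast
    next
      case False
      then obtain x where x: "x \<in> e" "x \<in> W" by blast
      then obtain y where y: "e = {y, x}" using card2[OF e] by (auto simp: card_2_iff)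
      have "y \<in> ?A"
      proof (cases "y \<in> U")
        case True
        then show ?thesis using a(2)[OF True x(2)] e y by simp
      next
        case False
        then have "(x, y) \<in> r" using e y WV[OF x(2)] unfolding r_def by (simp add: insert_commute)
        then show ?thesis using x(2) unfolding W_def by (auto intro: rtrancl_into_rtrancl)
      qed
      then show ?thesis using e x(2) y by simp
    qed
  qed
  then have "card E \<le> card ({e \<in> E. e \<subseteq> ?A} \<union> {e \<in> E. e \<subseteq> ?B})"
    using finE by (intro card_mono) auto
  also have "\<dots> \<le> card {e \<in> E. e \<subseteq> ?A} + card {e \<in> E. e \<subseteq> ?B}" by (rule card_Un_le)
  finally show False
    using sparse[OF A cA(2)] sparse[OF B cB2] cA(1) cB dense by linarith
qed

text \<open>A maximal nonempty subgraph with a face family is all of \<open>E\<close>, since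
  otherwise an ear could be added.\<close>

lemma (in plane_graph) face_family_exists:
  assumes V2: "2 \<le> card V"
    and sparse: "\<And>A. A \<subset> V \<Longrightarrow> 2 \<le> card A \<Longrightarrow> card {e \<in> E. e \<subseteq> A} + 3 \<le> 2 * card A"
    and dense: "2 * card V < card E + 3"
  shows "\<exists>\<R>. face_family E \<R>"
proof -
  define S where "S = {H. H \<subseteq> E \<and> H \<noteq> {} \<and> (\<exists>\<R>. face_family H \<R>)}"
  have finS: "finite S" by (rule finite_subset[of _ "Pow E"]) (use finite_edges in \<open>auto simp: S_def\<close>)
  have big: "2 \<le> card (\<Union>H)" if H: "H \<subseteq> E" "H \<noteq> {}" for H
  proof -
    obtain e where e: "e \<in> H" using H(2) by blast
    have "card e \<le> card (\<Union>H)"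
      by (rule card_mono[OF finite_subset[OF Union_subset_V[OF H(1)] finite_vertices]]) (use e in blast)
    then show ?thesis using edge_card[of e] e H(1) by auto
  qed
  have "S \<noteq> {}"
  proof -
    have "2 \<le> card E" using V2 dense by linarith
    then obtain e where e: "e \<in> E" by fastforce
    have "{e} \<noteq> E" using \<open>2 \<le> card E\<close> by auto
    \<comment> \<open>The first cycle is an ear of the single edge \<open>e\<close>, closed up by
      \<open>e\<close>.\<close>
    from ear_exists[OF graph _ this big sparse dense] e obtain u ps w where
      ear: "distinct (u # ps @ [w])" "path_edges (u # ps @ [w]) \<subseteq> E" "path_edges (u # ps @ [w]) \<inter> {e} = {}"
      "u \<in> \<Union>{e}" "w \<in> \<Union>{e}"
      by auto
    have "u \<noteq> w" using ear(1) by auto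
    then have euw: "e = {w, u}" using ear(4,5) edge_card[OF e] by (auto simp: card_2_iff)
    have "ps \<noteq> []"
    proof
      assume "ps = []"
      then show False using ear(3) euw by (simp add: insert_commute)
    qed
    then have len: "3 \<le> Suc (length (ps @ [w]))" by (cases ps) auto
    have "path_edges (u # (ps @ [w]) @ [u]) \<subseteq> E"
      using closed_path_edges[of "ps @ [w]" u] ear(2) e euw by simp
    then have "is_cycle E (Suc (length (ps @ [w]))) (path_edges (u # (ps @ [w]) @ [u]))"
      unfolding is_cycle_iff using ear(1) len by (intro conjI exI[of _ u] exI[of _ "ps @ [w]"]) auto
    from face_family_cycle[OF this] have "path_edges (u # (ps @ [w]) @ [u]) \<in> S"
      using \<open>path_edges (u # (ps @ [w]) @ [u]) \<subseteq> E\<close> closed_path_edges[of "ps @ [w]" u] unfolding S_def by blast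
    then show ?thesis by blast
  qed
  then obtain H where H: "H \<in> S" "\<And>H'. H' \<in> S \<Longrightarrow> H \<subseteq> H' \<Longrightarrow> H = H'"
    using finite_has_maximal[OF finS] by blast
  from H(1) obtain \<R> where HE: "H \<subseteq> E" "H \<noteq> {}" and ff: "face_family H \<R>" unfolding S_def by blast
  have "H = E"
  proof (rule ccontr)
    assume "H \<noteq> E"
    from ear_exists[OF graph HE(1) this big[OF HE] sparse dense] obtain u ps w where
      ear: "distinct (u # ps @ [w])" "path_edges (u # ps @ [w]) \<subseteq> E" "path_edges (u # ps @ [w]) \<inter> H = {}"
      "u \<in> \<Union>H" "w \<in> \<Union>H" "set ps \<inter> \<Union>H = {}" by metis
    have "H \<union> path_edges (u # ps @ [w]) \<in> S"
      using face_family_ear[OF ff HE(1) ear] HE ear(2) unfolding S_def by simp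
    then have "H = H \<union> path_edges (u # ps @ [w])" by (rule H(2)) simp
    then have "path_edges (u # ps @ [w]) = {}" using ear(3) by blast
    then show False by (cases ps) auto
  qed
  then show ?thesis using ff by blast
qed

text \<open>Euler's formula and \<open>2 * card \<R> \<le> card E\<close> even give
  \<open>card E + 4 \<le> 2 * card V\<close>; the weaker constant is due to the single
  cycle.\<close>

lemma (in plane_graph) face_family_edge_bound:
  assumes tri: "separated_triangles E \<or> nonadjacent_triangles E"
    and ff: "face_family E \<R>"
  shows "card E + 3 \<le> 2 * card V"
proof -
  have euler: "card \<R> + card (\<Union>E) = card E + 2"
    and cyc: "\<And>R. R \<in> \<R> \<Longrightarrow> \<exists>n. is_cycle E n (bd R)"
    and two: "\<And>e. e \<in> E \<Longrightarrow> card {R \<in> \<R>. e \<in> bd R} = 2"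
    and injbd: "inj_on bd \<R> \<or> card \<R> = 2 \<and> (\<forall>R\<in>\<R>. bd R = E)"
    using ff unfolding face_family_def by (elim conjE; blast)+
  have UV: "card (\<Union>E) \<le> card V" by (rule card_mono[OF finite_vertices Union_subset_V]) simp
  from injbd show ?thesis
  proof
    assume inj: "inj_on bd \<R>"
    have "face_system E (bd ` \<R>)"
    proof
      show "finite E" by (rule finite_edges)
      show "\<exists>n. is_cycle E n C" if "C \<in> bd ` \<R>" for C using that cyc by blast
      show "card {C \<in> bd ` \<R>. e \<in> C} = 2" if "e \<in> E" for e
      proof -
        have "{C \<in> bd ` \<R>. e \<in> C} = bd ` {R \<in> \<R>. e \<in> bd R}" by blast
        moreover have "inj_on bd {R \<in> \<R>. e \<in> bd R}" by (rule inj_on_subset[OF inj]) blast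
        ultimately show ?thesis using two[OF that] card_image[of bd "{R \<in> \<R>. e \<in> bd R}"] by simp
      qed
    qed
    then have "2 * card (bd ` \<R>) \<le> card E"
      using tri face_system.separated_faces_bound face_system.nonadjacent_faces_bound by metis
    then show ?thesis using card_image[OF inj] euler UV by linarith
  next
    \<comment> \<open>By Euler's formula the cycle has as many vertices as edges, at least 3; a
      triangle attains the bound.\<close>
    assume 2: "card \<R> = 2 \<and> (\<forall>R\<in>\<R>. bd R = E)"
    then have "\<R> \<noteq> {}" by auto
    then obtain R where R: "R \<in> \<R>" by blast
    obtain n where "is_cycle E n (bd R)" using cyc[OF R] by blast
    then have n: "is_cycle E n E" using 2 R by simp
    then have "3 \<le> card E" using is_cycle_card[OF n] by (simp add: is_cycle_def)
    then show ?thesis using euler UV 2 by linarith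
  qed
qed

section \<open>Induction on the number of vertices\<close>

lemma plane_drawing_subgraph:
  assumes D: "plane_drawing V E p \<gamma>" and V': "V' \<subseteq> V" and F: "F \<subseteq> E" "\<And>e. e \<in> F \<Longrightarrow> e \<subseteq> V'"
  shows "plane_drawing V' F p \<gamma>"
proof -
  have inj: "inj_on p V" and arcs: "\<forall>e\<in>E. arc (\<gamma> e) \<and> {pathstart (\<gamma> e), pathfinish (\<gamma> e)} = p ` e"
    and meet: "\<forall>e\<in>E. path_image (\<gamma> e) \<inter> p ` V = p ` e"
    and cross: "\<forall>e\<in>E. \<forall>f\<in>E. e \<noteq> f \<longrightarrow> path_image (\<gamma> e) \<inter> path_image (\<gamma> f) \<subseteq> p ` (e \<inter> f)"
    using D unfolding plane_drawing_def by - (elim conjE, assumption)+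
  have "path_image (\<gamma> e) \<inter> p ` V' = p ` e" if "e \<in> F" for e
  proof -
    have sub: "p ` e \<subseteq> p ` V'" "p ` V' \<subseteq> p ` V" using F(2)[OF that] V' by (simp_all only: image_mono)
    have "path_image (\<gamma> e) \<inter> p ` V' = path_image (\<gamma> e) \<inter> p ` V \<inter> p ` V'"
      unfolding Int_assoc Int_absorb1[OF sub(2)] ..
    also have "\<dots> = p ` e \<inter> p ` V'" by (simp only: bspec[OF meet subsetD[OF F(1) that]])
    also have "\<dots> = p ` e" by (rule Int_absorb2[OF sub(1)])
    finally show ?thesis .
  qed
  moreover have "\<forall>e\<in>F. arc (\<gamma> e) \<and> {pathstart (\<gamma> e), pathfinish (\<gamma> e)} = p ` e"
    by (rule ballI, rule bspec[OF arcs], rule subsetD[OF F(1)])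
  moreover have "\<forall>e\<in>F. \<forall>f\<in>F. e \<noteq> f \<longrightarrow> path_image (\<gamma> e) \<inter> path_image (\<gamma> f) \<subseteq> p ` (e \<inter> f)"
    by (intro ballI, rule bspec[OF bspec[OF cross]]) (rule subsetD[OF F(1)], assumption)+
  ultimately show ?thesis
    unfolding plane_drawing_def by (intro conjI ballI inj_on_subset[OF inj V']) simp_all
qed

text \<open>The maps \<open>p\<close> and \<open>\<gamma>\<close> stay fixed while the graph
  shrinks: proper induced subgraphs inherit the drawing and the condition, so the induction
  hypothesis supplies the sparsity that \<open>ear_exists\<close> needs.\<close>

lemma plane_graph_sparse:
  assumes "simple_graph V E" "plane_drawing V E p \<gamma>"
    and "separated_triangles E \<or> nonadjacent_triangles E" and "2 \<le> card V"
  shows "card E + 3 \<le> 2 * card V"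
  using assms
proof (induction "card V" arbitrary: V E rule: less_induct)
  case less
  interpret plane_graph V E p \<gamma> using less.prems by unfold_locales
  show ?case
  proof (rule ccontr)
    assume "\<not> ?case"
    then have dense: "2 * card V < card E + 3" by simp
    have sparse: "card {e \<in> E. e \<subseteq> A} + 3 \<le> 2 * card A" if A: "A \<subset> V" "2 \<le> card A" for A
    proof (rule less.hyps)
      show "card A < card V" by (rule psubset_card_mono[OF finite_vertices A(1)])
      show "simple_graph A {e \<in> E. e \<subseteq> A}"
        using less.prems(1) A(1) finite_subset[of A V] by (auto simp: simple_graph_def)
      show "plane_drawing A {e \<in> E. e \<subseteq> A} p \<gamma>"
        by (rule plane_drawing_subgraph[OF less.prems(2)]) (use A(1) in auto)
      have "{e \<in> E. e \<subseteq> A} \<subseteq> E" by blast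
      then show "separated_triangles {e \<in> E. e \<subseteq> A} \<or> nonadjacent_triangles {e \<in> E. e \<subseteq> A}"
        using less.prems(3) separated_triangles_mono nonadjacent_triangles_mono finite_edges by metis
    qed (rule A(2))
    obtain \<R> where "face_family E \<R>" using face_family_exists[OF less.prems(4) sparse dense] by blast
    then show False using face_family_edge_bound[OF less.prems(3)] dense by fastforce
  qed
qed

theorem corollary4p2:
  fixes V :: "'a set" and E :: "'a set set"
  assumes "simple_graph V E"
    and "planar V E"
    and "((\<forall>T T'. is_triangle E T \<and> is_triangle E T' \<longrightarrow> \<not> intersecting_cycles T T') \<and>
          (\<forall>T. is_triangle E T \<longrightarrow> card {Q. is_cycle E 4 Q \<and> adjacent_cycles T Q} \<le> 1))
       \<or> ((\<forall>T C. is_triangle E T \<and> (is_triangle E C \<or> is_cycle E 4 C) \<longrightarrow> \<not> adjacent_cycles T C) \<and>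
          (\<forall>P. is_cycle E 5 P \<longrightarrow> card {T. is_triangle E T \<and> adjacent_cycles P T} \<le> 3))"
  shows "single_conflict_colorable V E 3"
proof (rule single_conflict_colorable_if_sparse[OF assms(1)])
  fix F assume F: "F \<subseteq> E"
  obtain p \<gamma> where D: "plane_drawing V E p \<gamma>" using assms(2) unfolding planar_def by blast
  interpret plane_graph V E p \<gamma> using assms(1) D by unfold_locales
  show "card F \<le> 2 * card (\<Union>F)"
  proof (cases "F = {}")
    case False
    then obtain e where e: "e \<in> F" by blast
    have finU: "finite (\<Union>F)" by (rule finite_subset[OF Union_subset_V[OF F] finite_vertices])
    have "card e \<le> card (\<Union>F)" by (rule card_mono[OF finU]) (use e in blast)
    then have two: "2 \<le> card (\<Union>F)" using edge_card[of e] e F by auto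
    have "separated_triangles E \<or> nonadjacent_triangles E"
      using assms(3) unfolding separated_triangles_def nonadjacent_triangles_def .
    then have tri: "separated_triangles F \<or> nonadjacent_triangles F"
      using separated_triangles_mono[OF _ F finite_edges] nonadjacent_triangles_mono[OF _ F finite_edges] by metis
    \<comment> \<open>The vertex set is cut down to \<open>\<Union>F\<close>, since Hall's condition
      compares \<open>F\<close> with the vertices it covers.\<close>
    have "simple_graph (\<Union>F) F"
      unfolding simple_graph_def using finU F edge_card by blast
    moreover have "plane_drawing (\<Union>F) F p \<gamma>"
      by (rule plane_drawing_subgraph[OF D Union_subset_V[OF F] F]) blast
    ultimately have "card F + 3 \<le> 2 * card (\<Union>F)" using plane_graph_sparse tri two by metis
    then show ?thesis by simp
  qed simp
qed

end
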